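(* Let $\alpha\ge1/2$ and let $\{P_\theta:\theta\in\Theta\}$, $\Theta=(-\eta,\eta)$, $\Theta_1=\Theta\setminus\{0\}$, be a family of probability distributions on $[0,\infty)$ as described in the context, with $dP_\theta/dP_0=1+\theta h_\theta$ and $h_\theta\to h$ in $L^2(P_0)$ as $\theta\to0$. Let $X_1,X_2,\ldots$ be i.i.d. with distribution $P_\theta$ and let $T_n=(T_n^2)^{1/2}\ge0$. Then the sequence of test statistics $\{T_n:n\in\mathbb{N}\}$ satisfies the Wieand condition, i.e., there exists a constant $\theta^*>0$ such that for any $\epsilon>0$ and $\gamma\in(0,1)$ there exists a constant $C>0$ such that $$P_\theta\big(|n^{-1/2}T_n-b(\theta)|<\epsilon\,b(\theta)\big)>1-\gamma$$ for any $\theta\in\Theta_1\cap(-\theta^*,\theta^* )$ and $n>C/b^2(\theta)$.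
   Context: Family: $P_0=Gamma(\alpha,1)$, with density $x^{\alpha-1}e^{-x}/\Gamma(\alpha)$, $x>0$; $\eta>0$; for $\theta\in\Theta_1$, $dP_\theta/dP_0=1+\theta h_\theta$, where $h_\theta$ satisfies $\int_0^\infty h_\theta\,dP_0=0$ and it is assumed that $\int_0^\infty xh_\theta(x)\,dP_0(x)=0$; as $\theta\to0$, $h_\theta\to h$ in $L^2(P_0)$. For $\theta\in\Theta_1$ (the alternative hypothesis), $P_\theta\ne P_0$. Test statistic: with $\overline{X}_n=n^{-1}\sum_{j=1}^nX_j$ and $Y_j=X_j/\overline{X}_n$ ($Y_j=0$ if $\overline{X}_n=0$), $$T_n^2=n\int_0^\infty\Big[\frac1n\sum_{j=1}^n\Gamma(\alpha)(tY_j)^{(1-\alpha)/2}J_{\alpha-1}\big(2\sqrt{tY_j}\big)-e^{-t/\alpha}\Big]^2dP_0(t),$$ where $J_\nu(z)=\sum_{j\ge0}\frac{(-1)^j}{j!\,\Gamma(\nu+1+j)}(z/2)^{2j+\nu}$, and $x^{(1-\alpha)/2}J_{\alpha-1}(2\sqrt x)$ equals $1/\Gamma(\alpha)$ at $x=0$. The function $b:\Theta_1\to(0,\infty)$ is the positive square root of $$b^2(\theta)=\theta^2\int_0^\infty\Big[\int_0^\infty\Gamma(\alpha)(tx/\alpha)^{(1-\alpha)/2}J_{\alpha-1}\big(2(tx/\alpha)^{1/2}\big)h_\theta(x)\,dP_0(x)\Big]^2dP_0(t).$$ *)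

theory Defs
  imports "HOL-Probability.Probability"
begin

definition gamma_distribution :: "real \<Rightarrow> real measure" where
  "gamma_distribution \<alpha> =
     density lborel (\<lambda>x. ennreal (if 0 < x then x powr (\<alpha> - 1) * exp (- x) / Gamma \<alpha> else 0))"

(* Meaningful for z > 0, and for z = 0 if \<nu> \<ge> 0. The case \<nu> = 0 is separated because
   0 powr 0 = 0 in HOL, whereas J_0(0) = 1. *)
definition bessel_J :: "real \<Rightarrow> real \<Rightarrow> real" where
  "bessel_J \<nu> z =
     (\<Sum>j. (-1) ^ j / (fact j * Gamma (\<nu> + 1 + real j)) *
           (if \<nu> = 0 then (z / 2) ^ (2 * j) else (z / 2) powr (2 * real j + \<nu>)))"

(* At x = 0 the factor x^((1 - \<alpha>)/2) J_(\<alpha> - 1)(2 sqrt x) is given its limit 1 / Gamma \<alpha>. *)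
definition hankel_kernel :: "real \<Rightarrow> real \<Rightarrow> real" where
  "hankel_kernel \<alpha> x =
     Gamma \<alpha> * (if x = 0 then 1 / Gamma \<alpha>
                 else x powr ((1 - \<alpha>) / 2) * bessel_J (\<alpha> - 1) (2 * sqrt x))"

definition sample_mean :: "nat \<Rightarrow> (nat \<Rightarrow> real) \<Rightarrow> real" where
  "sample_mean n x = (\<Sum>j = 1..n. x j) / real n"

definition scaled_sample :: "nat \<Rightarrow> (nat \<Rightarrow> real) \<Rightarrow> nat \<Rightarrow> real" where
  "scaled_sample n x j = (if sample_mean n x = 0 then 0 else x j / sample_mean n x)"

(* gamma_distribution \<alpha> is concentrated on (0, \<infinity>), so the integrals over the real line
   here and in wieand_b are the integrals over (0, \<infinity>). *)
definition T_squared :: "real \<Rightarrow> nat \<Rightarrow> (nat \<Rightarrow> real) \<Rightarrow> real" where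
  "T_squared \<alpha> n x =
     real n * (\<integral>t. ((1 / real n) * (\<Sum>j = 1..n. hankel_kernel \<alpha> (t * scaled_sample n x j))
                   - exp (- t / \<alpha>))\<^sup>2 \<partial>gamma_distribution \<alpha>)"

definition T_statistic :: "real \<Rightarrow> nat \<Rightarrow> (nat \<Rightarrow> real) \<Rightarrow> real" where
  "T_statistic \<alpha> n x = sqrt (T_squared \<alpha> n x)"

definition wieand_b :: "real \<Rightarrow> (real \<Rightarrow> real \<Rightarrow> real) \<Rightarrow> real \<Rightarrow> real" where
  "wieand_b \<alpha> h \<theta> =
     sqrt (\<theta>\<^sup>2 * (\<integral>t. (\<integral>x. hankel_kernel \<alpha> (t * x / \<alpha>) * h \<theta> x \<partial>gamma_distribution \<alpha>)\<^sup>2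
                   \<partial>gamma_distribution \<alpha>))"

(* M \<theta> is the probability on the sample space under which the parameter is \<theta>. *)
definition wieand_condition ::
  "real set \<Rightarrow> (real \<Rightarrow> 'w measure) \<Rightarrow> (nat \<Rightarrow> 'w \<Rightarrow> real) \<Rightarrow> (real \<Rightarrow> real) \<Rightarrow> bool" where
  "wieand_condition \<Theta>\<^sub>1 M T b \<longleftrightarrow>
     (\<exists>\<theta>s>0. \<forall>\<epsilon>>0. \<forall>\<gamma>. 0 < \<gamma> \<and> \<gamma> < 1 \<longrightarrow>
       (\<exists>C>0. \<forall>\<theta> \<in> \<Theta>\<^sub>1 \<inter> {-\<theta>s<..<\<theta>s}. \<forall>n::nat. real n > C / (b \<theta>)\<^sup>2 \<longrightarrow>
          measure (M \<theta>) {\<omega> \<in> space (M \<theta>). \<bar>T n \<omega> / sqrt (real n) - b \<theta>\<bar> < \<epsilon> * b \<theta>} > 1 - \<gamma>))"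

end

theory Submission
  imports Defs
begin

text \<open>
  Up to the factor \<open>sqrt n\<close>, the statistic is the distance in \<open>L\<^sup>2(P\<^sub>0)\<close> between the empirical Hankel
  transform of the sample, scaled by its mean, and \<open>exp (- t / \<alpha>)\<close>. By
  \<open>bessel_kernel_hankel_transform\<close> the latter is the Hankel transform of \<open>P\<^sub>0\<close> scaled by its mean
  \<open>\<alpha>\<close>. Hence \<open>b(\<theta>)\<close> is the same distance with the empirical transform replaced by the transform of
  \<open>P\<^sub>\<theta>\<close> scaled by \<open>\<alpha>\<close>, and by the triangle inequality the deviation of \<open>T\<^sub>n / sqrt n\<close> from \<open>b(\<theta>)\<close> is
  at most the distance between these two transforms. It is enough that the mean square of this
  distance is at most \<open>K / n\<close> with \<open>K\<close> independent of \<open>\<theta>\<close>: by Markov's inequality the deviation then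
  exceeds \<open>\<epsilon> b(\<theta>)\<close> with probability at most \<open>K / (n \<epsilon>\<^sup>2 b(\<theta>)\<^sup>2)\<close>, which is the Wieand condition.

  For \<open>\<alpha> \<ge> 1/2\<close> the kernel is bounded by \<open>1\<close> and has Lipschitz constant \<open>1 / \<alpha>\<close> on the positive half
  line; both follow from an energy that decreases along the Bessel equation
  (\<open>abs_normalized_bessel_le_1\<close>). Boundedness controls the fluctuation of the empirical transform at
  the scale \<open>\<alpha>\<close>. The Lipschitz property shows that scaling by the sample mean instead of \<open>\<alpha>\<close> costs
  at most \<open>t / \<alpha>\<^sup>2\<close> times the error of the sample mean (\<open>kernel_average_scaled_sample_diff_le\<close>), whose
  mean square is the variance of \<open>P\<^sub>\<theta>\<close> divided by \<open>n\<close>. That variance is bounded uniformly for small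
  \<open>\<theta>\<close> because the \<open>L\<^sup>2\<close> norm of \<open>h\<^sub>\<theta>\<close> is (\<open>tilted_gamma_variance_le\<close>).

  The argument also needs \<open>b(\<theta>) > 0\<close>, that is, injectivity of the Hankel transform
  (\<open>hankel_transform_injective\<close>). Averaging the transform over dilated gamma distributions yields the
  Laplace transform at the positive integers, that is, the moments of \<open>exp (- X)\<close>, and these determine the
  distribution of \<open>X\<close>.
\<close>

section \<open>The normalized Bessel function\<close>

text \<open>
  The hypergeometric function ${}_0F_1(;a;-x) = \Gamma(a)\,x^{(1-a)/2}J_{a-1}(2\sqrt x)$. As an entire
  function of \<open>x\<close> it has termwise derivatives without exceptional behaviour at \<open>0\<close>.
\<close>

definition normalized_bessel :: "real \<Rightarrow> real \<Rightarrow> real" where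
  "normalized_bessel a x = (\<Sum>j. (-1) ^ j / (fact j * pochhammer a j) * x ^ j)"

lemma pochhammer_ge_power:
  fixes a :: real
  assumes "a > 0"
  shows "a ^ n \<le> pochhammer a n"
proof (induction n)
  case (Suc n)
  have "a ^ n * a \<le> pochhammer a n * (a + real n)"
    using Suc assms by (intro mult_mono) (auto intro: pochhammer_nonneg)
  then show ?case
    by (simp add: pochhammer_Suc mult.commute)
qed simp

lemma normalized_bessel_summable:
  fixes a x :: real
  assumes "a > 0"
  shows "summable (\<lambda>j. \<bar>(-1) ^ j / (fact j * pochhammer a j) * x ^ j\<bar>)"
proof (rule summable_comparison_test')
  show "summable (\<lambda>j. inverse (fact j) * (\<bar>x\<bar> / a) ^ j)"
    by (rule summable_exp)
  fix j :: nat assume "0 \<le> j"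
  have "\<bar>x\<bar> ^ j / (fact j * pochhammer a j) \<le> \<bar>x\<bar> ^ j / (fact j * a ^ j)"
    using assms pochhammer_ge_power[OF assms, of j]
    by (intro divide_left_mono mult_left_mono mult_pos_pos pochhammer_pos) auto
  then show "norm \<bar>(-1) ^ j / (fact j * pochhammer a j) * x ^ j\<bar> \<le> inverse (fact j) * (\<bar>x\<bar> / a) ^ j"
    using assms pochhammer_pos[OF assms, of j]
    by (simp add: abs_mult power_abs divide_simps mult_ac)
qed

lemma normalized_bessel_sums:
  assumes "a > 0"
  shows "(\<lambda>j. (-1) ^ j / (fact j * pochhammer a j) * x ^ j) sums normalized_bessel a x"
  unfolding normalized_bessel_def
  by (intro summable_sums normalized_bessel_summable[THEN summable_rabs_cancel] assms)

lemma normalized_bessel_0 [simp]: "normalized_bessel a 0 = 1"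
  unfolding normalized_bessel_def by (subst powser_zero) simp

lemma normalized_bessel_deriv:
  assumes "a > 0"
  shows "(normalized_bessel a has_field_derivative - (normalized_bessel (a + 1) x / a)) (at x)"
proof -
  define c :: "nat \<Rightarrow> real" where "c j = (-1) ^ j / (fact j * pochhammer a j)" for j
  have "((\<lambda>x. \<Sum>j. c j * x ^ j) has_field_derivative (\<Sum>j. diffs c j * x ^ j)) (at x)"
    unfolding c_def
    by (intro termdiffs_strong_converges_everywhere
        normalized_bessel_summable[THEN summable_rabs_cancel] assms)
  moreover have "diffs c j * x ^ j
      = - (1 / a) * ((-1) ^ j / (fact j * pochhammer (a + 1) j) * x ^ j)" for j
  proof -
    have "real (Suc j) * (- s / (real (Suc j) * f * (a * p))) * y = - (1 / a) * (s / (f * p) * y)"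
      if "p > 0" "f > 0" for s f p y :: real
      using that assms by (simp add: field_simps del: of_nat_Suc)
    from this[of "pochhammer (a + 1) j" "fact j" "(-1) ^ j" "x ^ j"] show ?thesis
      using assms by (simp add: diffs_def c_def pochhammer_rec pochhammer_pos)
  qed
  moreover have "(\<lambda>j. - (1 / a) * ((-1) ^ j / (fact j * pochhammer (a + 1) j) * x ^ j))
      sums (- (1 / a) * normalized_bessel (a + 1) x)"
    using assms by (intro sums_mult normalized_bessel_sums) auto
  ultimately show ?thesis
    by (simp add: c_def normalized_bessel_def[abs_def] sums_iff)
qed

text \<open>
  Together with \<open>normalized_bessel_deriv\<close> this is the differential equation
  \<open>x y'' + a y' + y = 0\<close> for \<open>y = normalized_bessel a\<close>, with the derivatives expressed through the
  functions of parameter \<open>a + 1\<close> and \<open>a + 2\<close>.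
\<close>

lemma normalized_bessel_contiguous:
  assumes "a > 0"
  shows "x * normalized_bessel (a + 2) x / (a * (a + 1))
    = normalized_bessel (a + 1) x - normalized_bessel a x"
proof -
  define d where "d j = (-1) ^ j / (fact j * pochhammer (a + 1) j) * x ^ j
    - (-1) ^ j / (fact j * pochhammer a j) * x ^ j" for j
  have "d sums (normalized_bessel (a + 1) x - normalized_bessel a x)"
    unfolding d_def using assms by (intro sums_diff normalized_bessel_sums) auto
  \<comment> \<open>the constant coefficients cancel, so the series may be shifted by one\<close>
  then have "(\<lambda>j. d (Suc j)) sums (normalized_bessel (a + 1) x - normalized_bessel a x)"
    by (subst sums_Suc_iff) (simp add: d_def)
  moreover have "d (Suc j)
      = x / (a * (a + 1)) * ((-1) ^ j / (fact j * pochhammer (a + 2) j) * x ^ j)" for j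
  proof -
    define q where "q = pochhammer (a + 2) j"
    have "a * ((a + 1) * q) = pochhammer a (Suc (Suc j))"
      by (simp add: pochhammer_rec q_def add.assoc)
    also have "\<dots> = pochhammer a (Suc j) * (a + real (Suc j))"
      by (rule pochhammer_Suc)
    finally have 1: "pochhammer a (Suc j) = a * (a + 1) * q / (a + real (Suc j))"
      using assms by (simp add: field_simps)
    have 2: "pochhammer (a + 1) (Suc j) = (a + 1) * q"
      by (simp add: pochhammer_rec q_def add.assoc)
    have "q > 0" using assms by (simp add: q_def pochhammer_pos)
    have "d (Suc j) = (-1) ^ Suc j * x ^ Suc j / (fact (Suc j) * ((a + 1) * q))
        * (1 - (a + real (Suc j)) / a)"
    proof -
      have "s / (f * (b * q)) * y - s / (f * (a * b * q / (a + t))) * y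
          = s * y / (f * (b * q)) * (1 - (a + t) / a)" if "f > 0" "b > 0" "t > 0" for s f b t y :: real
        using that assms \<open>q > 0\<close> by (simp add: field_simps)
      from this[of "fact (Suc j)" "a + 1" "real (Suc j)" "(-1) ^ Suc j" "x ^ Suc j"] show ?thesis
        unfolding d_def 1 2 using assms by (simp del: of_nat_Suc fact_Suc power_Suc)
    qed
    also have "1 - (a + real (Suc j)) / a = - (real (Suc j) / a)"
      using assms by (simp add: field_simps)
    finally have d: "d (Suc j) = (-1) ^ Suc j * x ^ Suc j / (fact (Suc j) * ((a + 1) * q)) * - (real (Suc j) / a)" .
    then show ?thesis
    proof -
      have "- s * (x * y) / (t * f * (b * q)) * - (t / a)
          = x / (a * b) * (s / (f * q) * y)" if "f > 0" "t > 0" "b > 0" for s f t b y :: real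
        using that assms \<open>q > 0\<close> by (simp add: field_simps)
      from this[of "fact j" "real (Suc j)" "a + 1" "(-1) ^ j" "x ^ j"] show ?thesis
        using d assms by (simp add: q_def del: of_nat_Suc)
    qed
  qed
  moreover have "(\<lambda>j. x / (a * (a + 1)) * ((-1) ^ j / (fact j * pochhammer (a + 2) j) * x ^ j))
      sums (x / (a * (a + 1)) * normalized_bessel (a + 2) x)"
    using assms by (intro sums_mult normalized_bessel_sums) auto
  ultimately show ?thesis
    using sums_unique2 by fastforce
qed

text \<open>
  For a solution \<open>y\<close> of \<open>x y'' + a y' + y = 0\<close> the energy \<open>y\<^sup>2 + x y'\<^sup>2\<close> has derivative
  \<open>(1 - 2 a) y'\<^sup>2\<close>, which is nonpositive exactly because \<open>a \<ge> 1/2\<close>. On the half line the energy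
  dominates \<open>y\<^sup>2\<close>, and it starts from \<open>1\<close>.
\<close>

lemma abs_normalized_bessel_le_1:
  assumes "a \<ge> 1 / 2" "x \<ge> 0"
  shows "\<bar>normalized_bessel a x\<bar> \<le> 1"
proof -
  have a: "a > 0" using assms by simp
  let ?F = "normalized_bessel a" and ?G = "normalized_bessel (a + 1)" and ?H = "normalized_bessel (a + 2)"
  define E where "E y = (?F y)\<^sup>2 + y * (?G y / a)\<^sup>2" for y
  have der: "(E has_field_derivative (1 - 2 * a) * (?G y / a)\<^sup>2) (at y)" for y
  proof -
    have G: "(?G has_field_derivative - (?H y / (a + 1))) (at y)"
      using normalized_bessel_deriv[of "a + 1" y] a by (simp add: add.assoc)
    have eq: "2 * (?F y * - (?G y / a)) + ((?G y / a)\<^sup>2 + y * (2 * (?G y / a * (- (?H y / (a + 1)) / a))))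
        = (1 - 2 * a) * (?G y / a)\<^sup>2"
    proof -
      have "y * (2 * (?G y / a * (- (?H y / (a + 1)) / a)))
          = - 2 * (?G y / a) * (y * ?H y / (a * (a + 1)))"
        by (simp add: mult_ac)
      also have "\<dots> = - 2 * (?G y / a) * (?G y - ?F y)"
        by (simp only: normalized_bessel_contiguous[OF a])
      finally have eq': "y * (2 * (?G y / a * (- (?H y / (a + 1)) / a)))
          = - 2 * (?G y / a) * (?G y - ?F y)" .
      show ?thesis unfolding eq' using a by (simp add: field_simps power2_eq_square)
    qed
    have sq: "((\<lambda>y. (f y)\<^sup>2) has_field_derivative 2 * (f y * d)) (at y)"
      if "(f has_field_derivative d) (at y)" for f :: "real \<Rightarrow> real" and d
      using DERIV_power[OF that, of 2] by (simp add: mult_ac)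
    show ?thesis
      unfolding E_def
      by (rule DERIV_cong[OF DERIV_add[OF sq[OF normalized_bessel_deriv[OF a]]
            DERIV_mult[OF DERIV_ident sq[OF DERIV_cdivide[OF G]]]]])
         (use eq in \<open>simp add: mult_ac\<close>)
  qed
  have "E x \<le> E 0"
  proof (rule DERIV_nonpos_imp_nonincreasing[OF \<open>x \<ge> 0\<close>])
    fix y show "\<exists>z. (E has_field_derivative z) (at y) \<and> z \<le> 0"
      using assms by (intro exI[of _ "(1 - 2 * a) * (?G y / a)\<^sup>2"] conjI der mult_nonpos_nonneg) auto
  qed
  then have "(?F x)\<^sup>2 \<le> 1"
    using mult_nonneg_nonneg[OF \<open>x \<ge> 0\<close> zero_le_power2[of "?G x / a"]] by (simp add: E_def)
  then show ?thesis by (simp add: abs_square_le_1)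
qed

text \<open>
  The derivative is \<open>- 1 / a\<close> times the function of parameter \<open>a + 1\<close>, to which the bound by \<open>1\<close>
  applies again.
\<close>

lemma normalized_bessel_lipschitz:
  assumes "a \<ge> 1 / 2" "x \<ge> 0" "y \<ge> 0"
  shows "\<bar>normalized_bessel a x - normalized_bessel a y\<bar> \<le> \<bar>x - y\<bar> / a"
proof -
  have "norm (normalized_bessel a x - normalized_bessel a y) \<le> 1 / a * norm (x - y)"
  proof (rule field_differentiable_bound[of "{0..}"])
    show "(normalized_bessel a has_field_derivative - (normalized_bessel (a + 1) z / a)) (at z within {0..})"
      for z using assms by (simp add: has_field_derivative_at_within[OF normalized_bessel_deriv])
    show "norm (- (normalized_bessel (a + 1) z / a)) \<le> 1 / a" if "z \<in> {0..}" for z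
      using abs_normalized_bessel_le_1[of "a + 1" z] that assms by (simp add: divide_right_mono)
  qed (use assms in auto)
  then show ?thesis by simp
qed

lemma hankel_kernel_measurable [measurable]: "hankel_kernel a \<in> borel_measurable borel"
  unfolding hankel_kernel_def[abs_def] bessel_J_def by measurable

text \<open>
  Each power \<open>(sqrt x) powr (2 j + a - 1)\<close> of the Bessel series is \<open>x ^ j\<close> times
  \<open>x powr ((a - 1) / 2)\<close>, which the prefactor of the kernel cancels.
\<close>

lemma hankel_kernel_eq_normalized_bessel:
  assumes "a > 0" "x \<ge> 0"
  shows "hankel_kernel a x = normalized_bessel a x"
proof (cases "x = 0")
  case True
  then show ?thesis using Gamma_real_pos[OF assms(1)] by (simp add: hankel_kernel_def)
next
  case False
  then have x: "x > 0" using assms by simp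
  define r where "r = x powr ((a - 1) / 2)"
  have r: "r > 0" using x by (simp add: r_def)
  have Ga: "Gamma a > 0" using assms by (simp add: Gamma_real_pos)
  have nn: "a \<notin> \<int>\<^sub>\<le>\<^sub>0" using assms by (auto elim!: nonpos_Ints_cases)
  have pw: "(if a - 1 = 0 then (2 * sqrt x / 2) ^ (2 * j)
      else (2 * sqrt x / 2) powr (2 * real j + (a - 1))) = r * x ^ j" for j
  proof -
    have "sqrt x powr (2 * real j + (a - 1)) = x powr ((2 * real j + (a - 1)) / 2)"
      using x by (simp add: powr_half_sqrt[symmetric] powr_powr)
    also have "(2 * real j + (a - 1)) / 2 = (a - 1) / 2 + real j"
      by (simp add: field_simps)
    also have "x powr \<dots> = r * x ^ j"
      using x by (simp add: powr_add r_def powr_realpow)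
    finally show ?thesis
      using x by (auto simp: r_def power_mult)
  qed
  have G: "Gamma (a - 1 + 1 + real j) = Gamma a * pochhammer a j" for j
    using pochhammer_Gamma[OF nn, of j] Ga by simp
  have "bessel_J (a - 1) (2 * sqrt x)
      = (\<Sum>j. (r / Gamma a) * ((-1) ^ j / (fact j * pochhammer a j) * x ^ j))"
    unfolding bessel_J_def pw G by (simp add: mult_ac)
  also have "\<dots> = r / Gamma a * normalized_bessel a x"
    using normalized_bessel_sums[OF assms(1)] unfolding normalized_bessel_def
    by (intro suminf_mult) (auto simp: sums_iff)
  finally have "hankel_kernel a x = x powr ((1 - a) / 2) * r * normalized_bessel a x"
    using x Ga by (simp add: hankel_kernel_def)
  also have "x powr ((1 - a) / 2) * r = 1"
    using x by (simp add: r_def powr_add[symmetric] field_simps)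
  finally show ?thesis by simp
qed

section \<open>The gamma distribution and its Hankel transform\<close>

lemma sets_gamma_distribution [simp, measurable_cong]: "sets (gamma_distribution a) = sets borel"
  by (simp add: gamma_distribution_def)

lemma space_gamma_distribution [simp]: "space (gamma_distribution a) = UNIV"
  by (simp add: gamma_distribution_def)

lemma AE_gamma_distribution_iff:
  assumes "a > 0" "Measurable.pred borel P"
  shows "(AE x in gamma_distribution a. P x) \<longleftrightarrow> (AE x in lborel. x > 0 \<longrightarrow> P x)"
proof -
  have pos: "x powr (a - 1) * exp (- x) / Gamma a > 0" if "x > 0" for x
    using that Gamma_real_pos[OF assms(1)] by simp
  have "(AE x in gamma_distribution a. P x) \<longleftrightarrow>
     (AE x in lborel. 0 < ennreal (if 0 < x then x powr (a - 1) * exp (- x) / Gamma a else 0) \<longrightarrow> P x)"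
    unfolding gamma_distribution_def using assms(2) by (subst AE_density) auto
  also have "\<dots> \<longleftrightarrow> (AE x in lborel. x > 0 \<longrightarrow> P x)"
    by (intro AE_cong) (use pos in auto)
  finally show ?thesis .
qed

lemma AE_gamma_distribution_pos:
  assumes "a > 0"
  shows "AE x in gamma_distribution a. x > 0"
  by (subst AE_gamma_distribution_iff[OF assms]) auto

lemma gamma_distribution_moment:
  assumes "a > 0"
  shows "has_bochner_integral (gamma_distribution a) (\<lambda>x. x ^ k) (pochhammer a k)"
proof (rule has_bochner_integral_nn_integral)
  show "(\<lambda>x. x ^ k) \<in> borel_measurable (gamma_distribution a)"
    by measurable
  show "AE x in gamma_distribution a. 0 \<le> x ^ k"
    using AE_gamma_distribution_pos[OF assms] by eventually_elim simp
  show "0 \<le> pochhammer a k"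
    using assms by (rule pochhammer_nonneg)
  have G: "Gamma a > 0" using assms by (rule Gamma_real_pos)
  have nn: "a \<notin> \<int>\<^sub>\<le>\<^sub>0" using assms by (auto elim!: nonpos_Ints_cases)
  have "(\<integral>\<^sup>+x. ennreal (x ^ k) \<partial>gamma_distribution a)
      = (\<integral>\<^sup>+x. ennreal (if 0 < x then x powr (a - 1) * exp (- x) / Gamma a else 0) * ennreal (x ^ k) \<partial>lborel)"
    unfolding gamma_distribution_def by (subst nn_integral_density) auto
  also have "\<dots> = (\<integral>\<^sup>+x. ennreal (inverse (Gamma a))
      * ennreal (indicator {0..} x * x powr (a + real k - 1) / exp x) \<partial>lborel)"
  proof (intro nn_integral_cong)
    fix x :: real
    show "ennreal (if 0 < x then x powr (a - 1) * exp (- x) / Gamma a else 0) * ennreal (x ^ k)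
      = ennreal (inverse (Gamma a)) * ennreal (indicator {0..} x * x powr (a + real k - 1) / exp x)"
    proof (cases "x > 0")
      case True
      have "x powr (a + real k - 1) = x powr (a - 1) * x ^ k"
        using True by (simp add: powr_realpow[symmetric] powr_add[symmetric] algebra_simps)
      then show ?thesis using True G
        by (simp add: ennreal_mult'[symmetric] exp_minus field_simps)
    qed (cases "x = 0"; simp)
  qed
  also have "\<dots> = ennreal (inverse (Gamma a)) * ennreal (Gamma (a + real k))"
    using assms by (subst nn_integral_cmult) (auto simp: Gamma_conv_nn_integral_real)
  also have "\<dots> = ennreal (pochhammer a k)"
    using G assms Gamma_real_pos[of "a + real k"]
    by (simp add: ennreal_mult'[symmetric] pochhammer_Gamma[OF nn] field_simps)
  finally show "(\<integral>\<^sup>+x. ennreal (x ^ k) \<partial>gamma_distribution a) = ennreal (pochhammer a k)" .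
qed

lemma integrable_gamma_distribution_power:
  "a > 0 \<Longrightarrow> integrable (gamma_distribution a) (\<lambda>x. x ^ k)"
  using gamma_distribution_moment by (auto simp: has_bochner_integral_iff)

lemma prob_space_gamma_distribution:
  assumes "a > 0"
  shows "prob_space (gamma_distribution a)"
proof
  have "has_bochner_integral (gamma_distribution a) (\<lambda>x. 1 :: real) 1"
    using gamma_distribution_moment[OF assms, of 0] by simp
  then have "(\<integral>\<^sup>+x. ennreal 1 \<partial>gamma_distribution a) = ennreal 1"
    by (subst nn_integral_eq_integral) (auto simp only: has_bochner_integral_iff zero_le_one AE_I2)
  then show "emeasure (gamma_distribution a) (space (gamma_distribution a)) = 1"
    by simp
qed

lemma normalized_bessel_measurable [measurable]:
  "normalized_bessel a \<in> borel_measurable borel"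
  unfolding normalized_bessel_def[abs_def] by measurable

text \<open>
  Termwise integration: the \<open>j\<close>-th moment of the gamma distribution is \<open>pochhammer a j\<close>, which is the
  factor that separates the Bessel series from the exponential series.
\<close>

lemma gamma_distribution_hankel_transform:
  assumes "a > 0" "c \<ge> 0"
  shows "(\<integral>t. normalized_bessel a (c * t) \<partial>gamma_distribution a) = exp (- c)"
proof -
  let ?G = "gamma_distribution a"
  define f :: "nat \<Rightarrow> real \<Rightarrow> real"
    where "f j t = (-1) ^ j / (fact j * pochhammer a j) * (c * t) ^ j" for j t
  have f_eq: "f j t = (-c) ^ j / (fact j * pochhammer a j) * t ^ j" for j t
    by (simp add: f_def power_mult_distrib power_minus[of c])
  have f: "has_bochner_integral ?G (f j) ((-c) ^ j / fact j)" for j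
    using has_bochner_integral_mult_right[OF gamma_distribution_moment[OF assms(1), of j],
      of "(-c) ^ j / (fact j * pochhammer a j)"] pochhammer_pos[OF assms(1), of j]
    by (simp add: f_eq[abs_def])
  have nf: "(\<integral>t. norm (f j t) \<partial>?G) = c ^ j / fact j" for j
  proof -
    have "(\<integral>t. norm (f j t) \<partial>?G) = (\<integral>t. c ^ j / (fact j * pochhammer a j) * t ^ j \<partial>?G)"
    proof (intro integral_cong_AE)
      show "AE t in ?G. norm (f j t) = c ^ j / (fact j * pochhammer a j) * t ^ j"
        using AE_gamma_distribution_pos[OF assms(1)]
        by eventually_elim
          (use assms pochhammer_pos[OF assms(1), of j] in \<open>simp add: f_eq abs_mult power_abs\<close>)
    qed (auto simp: f_eq)
    also have "\<dots> = c ^ j / fact j"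
      using gamma_distribution_moment[OF assms(1), of j] pochhammer_pos[OF assms(1), of j]
      by (simp add: has_bochner_integral_iff)
    finally show ?thesis .
  qed
  have "(\<lambda>j. integral\<^sup>L ?G (f j)) sums (\<integral>t. (\<Sum>j. f j t) \<partial>?G)"
  proof (rule sums_integral)
    show "integrable ?G (f j)" for j using f by (auto simp: has_bochner_integral_iff)
    show "AE t in ?G. summable (\<lambda>j. norm (f j t))"
      unfolding f_def real_norm_def using assms by (intro AE_I2 normalized_bessel_summable)
    show "summable (\<lambda>j. \<integral>t. norm (f j t) \<partial>?G)"
      unfolding nf using summable_exp[of c] by (simp add: field_simps)
  qed
  then have "(\<lambda>j. (-c) ^ j / fact j) sums (\<integral>t. normalized_bessel a (c * t) \<partial>?G)"
    using f by (simp add: has_bochner_integral_iff f_def normalized_bessel_def)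
  moreover have "(\<lambda>j. (-c) ^ j / fact j) sums exp (-c)"
    using exp_converges[of "-c"] by (simp add: field_simps)
  ultimately show ?thesis by (rule sums_unique2)
qed

section \<open>Distributions determined by moments or Laplace transforms\<close>

text \<open>
  For a distribution on \<open>[-1, 1]\<close> the exponential series may be integrated termwise, so the moments
  determine the characteristic function.
\<close>

lemma bounded_moments_determine_distribution:
  assumes "real_distribution M" "real_distribution N"
    and "AE x in M. \<bar>x\<bar> \<le> 1" "AE x in N. \<bar>x\<bar> \<le> 1"
    and "\<And>k. (\<integral>x. x ^ k \<partial>M) = (\<integral>x. x ^ k \<partial>N)"
  shows "M = N"
proof (rule Levy_uniqueness[OF assms(1,2)])
  have char: "(\<lambda>k. (\<i> * complex_of_real t) ^ k / fact k * complex_of_real (\<integral>x. x ^ k \<partial>L)) sums char L t"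
    if "real_distribution L" and AE: "AE x in L. \<bar>x\<bar> \<le> 1" for L t
  proof -
    interpret real_distribution L by fact
    define c where "c k = (\<i> * complex_of_real t) ^ k / fact k" for k
    have int: "integrable L (\<lambda>x. x ^ k)" for k
    proof (rule integrable_const_bound[where B = 1])
      show "AE x in L. norm (x ^ k) \<le> 1"
        using AE by eventually_elim (simp add: power_abs power_le_one)
    qed simp
    have "(\<lambda>k. integral\<^sup>L L (\<lambda>x. c k * complex_of_real (x ^ k)))
        sums (\<integral>x. (\<Sum>k. c k * complex_of_real (x ^ k)) \<partial>L)"
    proof (rule sums_integral)
      show "integrable L (\<lambda>x. c k * complex_of_real (x ^ k))" for k
        using int by (intro integrable_mult_right integrable_of_real) 
      show "AE x in L. summable (\<lambda>k. norm (c k * complex_of_real (x ^ k)))"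
      proof (intro AE_I2)
        fix x :: real
        show "summable (\<lambda>k. norm (c k * complex_of_real (x ^ k)))"
          using summable_norm_exp[of "\<i> * complex_of_real (t * x)"]
          by (simp add: c_def norm_mult norm_divide norm_power power_mult_distrib abs_mult field_simps)
      qed
      have "norm (\<integral>x. norm (c k * complex_of_real (x ^ k)) \<partial>L) \<le> inverse (fact k) * \<bar>t\<bar> ^ k" for k
      proof -
        have "(\<integral>x. norm (c k * complex_of_real (x ^ k)) \<partial>L) \<le> (\<integral>x. norm (c k) \<partial>L)"
        proof (intro integral_mono_AE integrable_norm)
          show "AE x in L. norm (c k * complex_of_real (x ^ k)) \<le> norm (c k)"
            using AE by eventually_elim
              (simp add: norm_mult norm_power power_le_one mult_left_le)
        qed (use int in \<open>auto intro!: integrable_mult_right integrable_of_real simp del: of_real_power\<close>)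
        then show ?thesis
          by (simp add: prob_space[simplified] c_def norm_divide norm_mult norm_power field_simps)
      qed
      then show "summable (\<lambda>k. \<integral>x. norm (c k * complex_of_real (x ^ k)) \<partial>L)"
        by (intro summable_comparison_test'[OF summable_exp])
    qed
    moreover have "(\<Sum>k. c k * complex_of_real (x ^ k)) = iexp (t * x)" for x
      using exp_converges[of "\<i> * complex_of_real (t * x)"]
      by (simp add: sums_iff c_def power_mult_distrib scaleR_conv_of_real field_simps)
    ultimately show ?thesis
      by (simp add: char_def c_def del: of_real_power)
  qed
  show "char M = char N"
    using sums_unique2[OF char[OF assms(1,3)]] char[OF assms(2,4)] assms(5) by (auto simp: fun_eq_iff)
qed

text \<open>
  The values of the Laplace transform at the integers are the moments of \<open>exp (- X)\<close>, which is bounded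
  by \<open>1\<close> and determines \<open>X\<close>.
\<close>

lemma laplace_transform_determines_distribution:
  fixes M N :: "real measure"
  assumes "real_distribution M" "real_distribution N"
    and "AE x in M. x \<ge> 0" "AE x in N. x \<ge> 0"
    and "\<And>k :: nat. (\<integral>x. exp (- (real k * x)) \<partial>M) = (\<integral>x. exp (- (real k * x)) \<partial>N)"
  shows "M = N"
proof -
  let ?D = "\<lambda>L. distr L borel (\<lambda>x. exp (- x) :: real)"
  interpret M: real_distribution M by fact
  interpret N: real_distribution N by fact
  have "?D M = ?D N"
  proof (rule bounded_moments_determine_distribution)
    show "(\<integral>x. x ^ k \<partial>?D M) = (\<integral>x. x ^ k \<partial>?D N)" for k
      using assms(5)[of k] by (simp add: integral_distr exp_of_nat_mult[symmetric])
  qed (use assms(3,4) in \<open>auto simp: AE_distr_iff\<close>)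
  moreover have "distr (?D L) borel (\<lambda>u. - ln u) = L" if "real_distribution L" for L
  proof -
    interpret real_distribution L by fact
    show ?thesis by (simp add: distr_distr o_def distr_id2)
  qed
  ultimately show ?thesis
    using assms(1,2) by metis
qed

section \<open>Injectivity of the Hankel transform\<close>

text \<open>
  Continued by the constant \<open>1\<close> to the negative half line, the kernel is bounded by \<open>1\<close> and
  Lipschitz on all of \<open>\<real>\<close>, so that integrability and measurability need no sign conditions. For the
  distributions considered, which are concentrated on \<open>(0, \<infinity>)\<close>, the integrals are those of the
  original kernel.
\<close>

definition bessel_kernel :: "real \<Rightarrow> real \<Rightarrow> real" where
  "bessel_kernel a x = normalized_bessel a (max 0 x)"

lemma bessel_kernel_measurable [measurable]: "bessel_kernel a \<in> borel_measurable borel"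
  unfolding bessel_kernel_def[abs_def] by measurable

lemma abs_bessel_kernel_le_1: "a \<ge> 1 / 2 \<Longrightarrow> \<bar>bessel_kernel a x\<bar> \<le> 1"
  by (simp add: bessel_kernel_def abs_normalized_bessel_le_1)

lemma bessel_kernel_lipschitz:
  assumes "a \<ge> 1 / 2"
  shows "\<bar>bessel_kernel a x - bessel_kernel a y\<bar> \<le> \<bar>x - y\<bar> / a"
proof -
  have "\<bar>bessel_kernel a x - bessel_kernel a y\<bar> \<le> \<bar>max 0 x - max 0 y\<bar> / a"
    unfolding bessel_kernel_def using assms by (intro normalized_bessel_lipschitz) auto
  also have "\<dots> \<le> \<bar>x - y\<bar> / a"
    using assms by (intro divide_right_mono) auto
  finally show ?thesis .
qed

lemma hankel_kernel_eq_bessel_kernel: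
  "a > 0 \<Longrightarrow> x \<ge> 0 \<Longrightarrow> hankel_kernel a x = bessel_kernel a x"
  by (simp add: bessel_kernel_def hankel_kernel_eq_normalized_bessel)

lemma bessel_kernel_hankel_transform:
  assumes "a > 0" "c \<ge> 0"
  shows "(\<integral>t. bessel_kernel a (c * t) \<partial>gamma_distribution a) = exp (- c)"
proof -
  have "(\<integral>t. bessel_kernel a (c * t) \<partial>gamma_distribution a)
      = (\<integral>t. normalized_bessel a (c * t) \<partial>gamma_distribution a)"
  proof (intro integral_cong_AE)
    show "AE t in gamma_distribution a. bessel_kernel a (c * t) = normalized_bessel a (c * t)"
      using AE_gamma_distribution_pos[OF assms(1)]
      by eventually_elim (use assms in \<open>simp add: bessel_kernel_def\<close>)
  qed measurable
  then show ?thesis using gamma_distribution_hankel_transform[OF assms] by simp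
qed

text \<open>
  The gamma distribution and its dilations have the same null sets, those of Lebesgue measure on the
  positive half line.
\<close>

lemma AE_gamma_distribution_scale:
  assumes "a > 0" "c > 0" and [measurable]: "Measurable.pred borel P"
    and "AE t in gamma_distribution a. P t"
  shows "AE t in gamma_distribution a. P (c * t)"
proof -
  have "AE t in lborel. t > 0 \<longrightarrow> P t"
    using assms by (subst (asm) AE_gamma_distribution_iff) auto
  then have "AE t in lborel. 0 + c * t > 0 \<longrightarrow> P (0 + c * t)"
    using assms(2) by (intro AE_borel_affine) auto
  then have "AE t in lborel. t > 0 \<longrightarrow> P (c * t)"
    by eventually_elim (use assms(2) in auto)
  then show ?thesis
    using assms(1) by (subst AE_gamma_distribution_iff) auto
qed

text \<open>
  By \<open>bessel_kernel_hankel_transform\<close>, \<open>exp (- k x)\<close> is the gamma average over \<open>t\<close> of the kernel at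
  \<open>k t x\<close>. By Fubini's theorem, the Laplace transform of \<open>g\<close> (against the gamma distribution) at \<open>k\<close>
  is therefore the gamma average over \<open>t\<close> of the Hankel transform of \<open>g\<close> at \<open>c k t\<close>.
\<close>

lemma laplace_transform_eq_0_if_hankel_transform_eq_0:
  fixes a c :: real and k :: nat
  assumes a: "a \<ge> 1 / 2" and c: "c > 0" and k: "k > 0"
    and g: "integrable (gamma_distribution a) g"
    and zero: "AE t in gamma_distribution a. (\<integral>x. bessel_kernel a (t * x / c) * g x \<partial>gamma_distribution a) = 0"
  shows "(\<integral>x. exp (- (real k * x)) * g x \<partial>gamma_distribution a) = 0"
proof -
  let ?G = "gamma_distribution a"
  have a0: "a > 0" using a by simp
  interpret G: prob_space ?G by (rule prob_space_gamma_distribution[OF a0])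
  interpret GG: pair_sigma_finite ?G ?G ..
  have [measurable]: "g \<in> borel_measurable borel" using g by (auto dest: borel_measurable_integrable)
  have bound: "\<bar>bessel_kernel a y * z\<bar> \<le> \<bar>z\<bar>" for y z
    using abs_bessel_kernel_le_1[OF a, of y] by (simp add: abs_mult mult_left_le_one_le)
  have intg: "integrable ?G (\<lambda>x. bessel_kernel a (real k * x * t) * g x)" for t
    by (rule Bochner_Integration.integrable_bound[OF g]) (auto simp: bound)
  have "integrable (?G \<Otimes>\<^sub>M ?G) (\<lambda>(t, x). bessel_kernel a (real k * x * t) * g x)"
  proof (rule GG.Fubini_integrable)
    have "norm (\<integral>x. \<bar>bessel_kernel a (real k * x * t) * g x\<bar> \<partial>?G) \<le> (\<integral>x. \<bar>g x\<bar> \<partial>?G)" for t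
      unfolding real_norm_def
      by (subst abs_of_nonneg) (auto intro!: integral_mono integrable_abs intg g bound)
    then show "integrable ?G (\<lambda>t. \<integral>x. norm (case (t, x) of (t, x) \<Rightarrow> bessel_kernel a (real k * x * t) * g x) \<partial>?G)"
      by (intro G.integrable_const_bound[where B = "\<integral>x. \<bar>g x\<bar> \<partial>?G"]) auto
  qed (auto simp: intg)
  then have "(\<integral>x. (\<integral>t. bessel_kernel a (real k * x * t) * g x \<partial>?G) \<partial>?G)
      = (\<integral>t. (\<integral>x. bessel_kernel a (real k * x * t) * g x \<partial>?G) \<partial>?G)"
    by (rule GG.Fubini_integral)
  also have "\<dots> = (\<integral>t. 0 \<partial>?G)"
  proof (intro integral_cong_AE)
    have "AE t in ?G. (\<integral>x. bessel_kernel a ((c * real k * t) * x / c) * g x \<partial>?G) = 0"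
      using a0 c k zero by (intro AE_gamma_distribution_scale[of a "c * real k"]) auto
    then show "AE t in ?G. (\<integral>x. bessel_kernel a (real k * x * t) * g x \<partial>?G) = 0"
      by eventually_elim (use c in \<open>simp add: mult_ac\<close>)
  qed auto
  finally have "(\<integral>x. (\<integral>t. bessel_kernel a (real k * x * t) * g x \<partial>?G) \<partial>?G) = 0"
    by simp
  moreover have "(\<integral>x. (\<integral>t. bessel_kernel a (real k * x * t) * g x \<partial>?G) \<partial>?G)
      = (\<integral>x. exp (- (real k * x)) * g x \<partial>?G)"
  proof (intro integral_cong_AE)
    show "AE x in ?G. (\<integral>t. bessel_kernel a (real k * x * t) * g x \<partial>?G) = exp (- (real k * x)) * g x"
      using AE_gamma_distribution_pos[OF a0]
      by eventually_elim (simp add: bessel_kernel_hankel_transform[OF a0])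
  qed auto
  ultimately show ?thesis by simp
qed

text \<open>
  The Laplace transforms of the two distributions agree at every positive integer by the preceding
  lemma, and at \<open>0\<close> because \<open>g\<close> has integral \<open>0\<close>.
\<close>

lemma hankel_transform_injective:
  fixes a c :: real
  assumes a: "a \<ge> 1 / 2" and c: "c > 0"
    and g: "has_bochner_integral (gamma_distribution a) g 0"
    and nonneg: "AE x in gamma_distribution a. 1 + g x \<ge> 0"
    and zero: "AE t in gamma_distribution a. (\<integral>x. bessel_kernel a (t * x / c) * g x \<partial>gamma_distribution a) = 0"
  shows "density (gamma_distribution a) (\<lambda>x. ennreal (1 + g x)) = gamma_distribution a" (is "?Q = ?G")
proof (rule laplace_transform_determines_distribution)
  have a0: "a > 0" using a by simp
  interpret G: prob_space ?G by (rule prob_space_gamma_distribution[OF a0])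
  have intg: "integrable ?G g" "(\<integral>x. g x \<partial>?G) = 0"
    using g by (auto simp: has_bochner_integral_iff)
  then have [measurable]: "g \<in> borel_measurable borel" by (auto dest: borel_measurable_integrable)
  show "real_distribution ?G"
    by (intro real_distribution.intro real_distribution_axioms.intro G.prob_space_axioms) auto
  have "(\<integral>\<^sup>+x. ennreal (1 + g x) \<partial>?G) = ennreal (\<integral>x. 1 + g x \<partial>?G)"
    using intg nonneg by (intro nn_integral_eq_integral) auto
  also have "\<dots> = 1" using intg by (simp add: G.prob_space[simplified])
  finally have "prob_space ?Q"
    by (intro prob_spaceI) (simp add: emeasure_density)
  then show "real_distribution ?Q"
    by (intro real_distribution.intro real_distribution_axioms.intro) auto
  show pos: "AE x in ?G. x \<ge> 0"
    using AE_gamma_distribution_pos[OF a0] by eventually_elim simp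
  show "AE x in ?Q. x \<ge> 0"
    using pos by (subst AE_density) auto
  fix k :: nat
  have e1: "integrable ?G (\<lambda>x. exp (- (real k * x)))"
    using pos by (intro G.integrable_const_bound[where B = 1]) auto
  have e2: "integrable ?G (\<lambda>x. exp (- (real k * x)) * g x)"
    using pos by (intro Bochner_Integration.integrable_bound[OF intg(1)])
      (auto simp: abs_mult mult_left_le_one_le elim!: eventually_mono)
  have "(\<integral>x. exp (- (real k * x)) * g x \<partial>?G) = 0"
    using laplace_transform_eq_0_if_hankel_transform_eq_0[OF a c _ intg(1) zero] intg(2)
    by (cases "k = 0") auto
  moreover have "(\<integral>x. exp (- (real k * x)) \<partial>?Q) = (\<integral>x. (1 + g x) * exp (- (real k * x)) \<partial>?G)"
    using nonneg by (subst integral_density) auto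
  ultimately show "(\<integral>x. exp (- (real k * x)) \<partial>?Q) = (\<integral>x. exp (- (real k * x)) \<partial>?G)"
    using e1 e2 by (simp add: algebra_simps)
qed

section \<open>Mean squares\<close>

lemma integrable_mult_of_square_integrable:
  fixes f g :: "'a \<Rightarrow> real"
  assumes [measurable]: "f \<in> borel_measurable M" "g \<in> borel_measurable M"
    and "integrable M (\<lambda>x. (f x)\<^sup>2)" "integrable M (\<lambda>x. (g x)\<^sup>2)"
  shows "integrable M (\<lambda>x. f x * g x)"
proof (rule Bochner_Integration.integrable_bound)
  show "integrable M (\<lambda>x. (f x)\<^sup>2 + (g x)\<^sup>2)" using assms by simp
  have "\<bar>u * v\<bar> \<le> u\<^sup>2 + v\<^sup>2" for u v :: real
    using sum_squares_bound[of "\<bar>u\<bar>" "\<bar>v\<bar>"] zero_le_power2[of u] zero_le_power2[of v]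
    unfolding abs_mult power2_abs by linarith
  then show "AE x in M. norm (f x * g x) \<le> norm ((f x)\<^sup>2 + (g x)\<^sup>2)" by simp
qed simp

text \<open>
  The Cauchy-Schwarz inequality, obtained by expanding the integral of the square of \<open>B f - A g\<close>,
  where \<open>A\<close> and \<open>B\<close> are the norms of \<open>f\<close> and \<open>g\<close>.
\<close>

lemma integral_mult_le_sqrt_mult_sqrt:
  fixes f g :: "'a \<Rightarrow> real"
  assumes [measurable]: "f \<in> borel_measurable M" "g \<in> borel_measurable M"
    and f: "integrable M (\<lambda>x. (f x)\<^sup>2)" and g: "integrable M (\<lambda>x. (g x)\<^sup>2)"
  shows "(\<integral>x. f x * g x \<partial>M) \<le> sqrt (\<integral>x. (f x)\<^sup>2 \<partial>M) * sqrt (\<integral>x. (g x)\<^sup>2 \<partial>M)"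
proof -
  define A where "A = sqrt (\<integral>x. (f x)\<^sup>2 \<partial>M)"
  define B where "B = sqrt (\<integral>x. (g x)\<^sup>2 \<partial>M)"
  note fg = integrable_mult_of_square_integrable[OF assms]
  have A2: "(\<integral>x. (f x)\<^sup>2 \<partial>M) = A\<^sup>2" and B2: "(\<integral>x. (g x)\<^sup>2 \<partial>M) = B\<^sup>2"
    and nn: "A \<ge> 0" "B \<ge> 0"
    by (simp_all add: A_def B_def)
  have zero: "(\<integral>x. f x * g x \<partial>M) = 0" if "A = 0 \<or> B = 0"
  proof -
    have "(AE x in M. (f x)\<^sup>2 = 0) \<or> (AE x in M. (g x)\<^sup>2 = 0)"
      using that A2 B2 f g by (auto simp: integral_nonneg_eq_0_iff_AE)
    then have "AE x in M. f x * g x = 0"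
      by (auto elim!: eventually_mono)
    then show ?thesis by (rule integral_eq_zero_AE)
  qed
  have "0 \<le> (\<integral>x. (B * f x - A * g x)\<^sup>2 \<partial>M)" by simp
  also have "\<dots> = (\<integral>x. B\<^sup>2 * (f x)\<^sup>2 + A\<^sup>2 * (g x)\<^sup>2 - 2 * A * B * (f x * g x) \<partial>M)"
    by (simp add: power2_eq_square algebra_simps)
  also have "\<dots> = B\<^sup>2 * A\<^sup>2 + A\<^sup>2 * B\<^sup>2 - 2 * A * B * (\<integral>x. f x * g x \<partial>M)"
    using f g fg by (simp add: A2 B2)
  also have "\<dots> = (2 * A * B) * (A * B - (\<integral>x. f x * g x \<partial>M))"
    by (simp add: power2_eq_square algebra_simps)
  finally have prod: "0 \<le> (2 * A * B) * (A * B - (\<integral>x. f x * g x \<partial>M))" .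
  have "(\<integral>x. f x * g x \<partial>M) \<le> A * B"
  proof (cases "A = 0 \<or> B = 0")
    case False
    then have "2 * A * B > 0" using nn by simp
    then show ?thesis using prod by (simp only: zero_le_mult_iff) linarith
  qed (use nn zero in auto)
  then show ?thesis by (simp add: A_def B_def)
qed

text \<open>
  The reverse triangle inequality in \<open>L\<^sup>2\<close>.
\<close>

lemma sqrt_integral_square_diff_le:
  fixes f g :: "'a \<Rightarrow> real"
  assumes [measurable]: "f \<in> borel_measurable M" "g \<in> borel_measurable M"
    and f: "integrable M (\<lambda>x. (f x)\<^sup>2)" and g: "integrable M (\<lambda>x. (g x)\<^sup>2)"
  shows "(sqrt (\<integral>x. (f x)\<^sup>2 \<partial>M) - sqrt (\<integral>x. (g x)\<^sup>2 \<partial>M))\<^sup>2 \<le> (\<integral>x. (f x - g x)\<^sup>2 \<partial>M)"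
proof -
  have "(\<integral>x. (f x - g x)\<^sup>2 \<partial>M) = (\<integral>x. (f x)\<^sup>2 + (g x)\<^sup>2 - 2 * (f x * g x) \<partial>M)"
    by (simp add: power2_diff mult.assoc)
  also have "\<dots> = (\<integral>x. (f x)\<^sup>2 \<partial>M) + (\<integral>x. (g x)\<^sup>2 \<partial>M) - 2 * (\<integral>x. f x * g x \<partial>M)"
    using f g integrable_mult_of_square_integrable[OF assms] by simp
  finally show ?thesis
    using integral_mult_le_sqrt_mult_sqrt[OF assms] by (simp add: power2_diff)
qed

text \<open>
  The mixed terms have expectation \<open>0\<close>: a new summand is independent of the sum of the earlier ones.
  Integrability and the bound are carried through one induction.
\<close>

lemma (in prob_space) indep_centered_sum_square:
  fixes Z :: "'i \<Rightarrow> 'a \<Rightarrow> real"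
  assumes "finite I" "indep_vars (\<lambda>_. borel) Z I"
    and "\<And>i. i \<in> I \<Longrightarrow> integrable M (Z i)"
    and "\<And>i. i \<in> I \<Longrightarrow> expectation (Z i) = 0"
    and "\<And>i. i \<in> I \<Longrightarrow> integrable M (\<lambda>\<omega>. (Z i \<omega>)\<^sup>2)"
    and "\<And>i. i \<in> I \<Longrightarrow> expectation (\<lambda>\<omega>. (Z i \<omega>)\<^sup>2) \<le> v"
  shows "integrable M (\<lambda>\<omega>. (\<Sum>i\<in>I. Z i \<omega>)\<^sup>2)
    \<and> expectation (\<lambda>\<omega>. (\<Sum>i\<in>I. Z i \<omega>)\<^sup>2) \<le> real (card I) * v"
  using assms
proof (induction I rule: finite_induct)
  case (insert i I)
  let ?S = "\<lambda>\<omega>. \<Sum>i\<in>I. Z i \<omega>"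
  have IH: "integrable M (\<lambda>\<omega>. (?S \<omega>)\<^sup>2)" "expectation (\<lambda>\<omega>. (?S \<omega>)\<^sup>2) \<le> real (card I) * v"
    using insert by (auto intro: indep_vars_subset)
  have ind: "indep_var borel (Z i) borel ?S"
    using insert by (intro indep_vars_sum) auto
  have S: "integrable M ?S" "expectation ?S = 0"
    using insert by (auto simp: Bochner_Integration.integral_sum)
  have Zi: "integrable M (Z i)" "expectation (Z i) = 0" "integrable M (\<lambda>\<omega>. (Z i \<omega>)\<^sup>2)"
    "expectation (\<lambda>\<omega>. (Z i \<omega>)\<^sup>2) \<le> v" using insert by auto
  have prod: "integrable M (\<lambda>\<omega>. Z i \<omega> * ?S \<omega>)" "expectation (\<lambda>\<omega>. Z i \<omega> * ?S \<omega>) = 0"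
    using indep_var_integrable[OF ind Zi(1) S(1)] indep_var_lebesgue_integral[OF ind Zi(1) S(1)]
    by (simp_all add: S(2))
  have "(\<lambda>\<omega>. (\<Sum>i\<in>insert i I. Z i \<omega>)\<^sup>2)
      = (\<lambda>\<omega>. (Z i \<omega>)\<^sup>2 + (?S \<omega>)\<^sup>2 + 2 * (Z i \<omega> * ?S \<omega>))"
    using insert(1,2) by (simp add: power2_sum mult.assoc)
  then show ?case
    using IH Zi prod insert(1,2) by (simp add: algebra_simps)
qed simp

lemma (in prob_space) sample_average_mean_square:
  fixes X :: "nat \<Rightarrow> 'a \<Rightarrow> real" and f :: "real \<Rightarrow> real"
  assumes ind: "indep_vars (\<lambda>_. borel) X {1..}"
    and Q: "\<And>j. j \<ge> 1 \<Longrightarrow> distr M borel (X j) = Q"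
    and f[measurable]: "f \<in> borel_measurable borel"
    and int: "has_bochner_integral Q f \<mu>" "integrable Q (\<lambda>x. (f x - \<mu>)\<^sup>2)"
    and v: "(\<integral>x. (f x - \<mu>)\<^sup>2 \<partial>Q) \<le> v"
    and n: "n > 0"
  shows "integrable M (\<lambda>\<omega>. ((\<Sum>j = 1..n. f (X j \<omega>)) / real n - \<mu>)\<^sup>2)"
    and "expectation (\<lambda>\<omega>. ((\<Sum>j = 1..n. f (X j \<omega>)) / real n - \<mu>)\<^sup>2) \<le> v / real n"
proof -
  have X[measurable]: "X j \<in> borel_measurable M" if "j \<ge> 1" for j
    using ind that by (auto simp: indep_vars_def)
  have sQ[measurable_cong, simp]: "sets Q = sets borel" using Q[of 1, symmetric] by simp
  interpret Q: prob_space Q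
    using prob_space_distr[OF X[of 1]] Q[of 1] by simp
  have intf: "integrable Q f" "integral\<^sup>L Q f = \<mu>"
    using int by (auto simp: has_bochner_integral_iff)
  define Z where "Z j \<omega> = f (X j \<omega>) - \<mu>" for j \<omega>
  have Z: "integrable M (\<lambda>\<omega>. k (X j \<omega>))" "expectation (\<lambda>\<omega>. k (X j \<omega>)) = integral\<^sup>L Q k"
    if "j \<ge> 1" "integrable Q k" for j and k :: "real \<Rightarrow> real"
  proof -
    have k[measurable]: "k \<in> borel_measurable borel"
      using that(2) by (auto dest: borel_measurable_integrable)
    show "integrable M (\<lambda>\<omega>. k (X j \<omega>))" "expectation (\<lambda>\<omega>. k (X j \<omega>)) = integral\<^sup>L Q k"
      using that X[OF that(1)] by (simp_all add: Q[OF that(1), symmetric] integrable_distr_eq integral_distr)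
  qed
  have main: "integrable M (\<lambda>\<omega>. (\<Sum>i\<in>{1..n}. Z i \<omega>)\<^sup>2)
    \<and> expectation (\<lambda>\<omega>. (\<Sum>i\<in>{1..n}. Z i \<omega>)\<^sup>2) \<le> real (card {1..n}) * v"
  proof (rule indep_centered_sum_square)
    show "indep_vars (\<lambda>_. borel) Z {1..n}"
      unfolding Z_def[abs_def]
      by (rule indep_vars_compose2[OF indep_vars_subset[OF ind]]) auto
  next
    fix j assume "j \<in> {1..n}"
    then have j: "j \<ge> 1" by simp
    show "integrable M (Z j)" "expectation (Z j) = 0"
      using Z[OF j, of "\<lambda>x. f x - \<mu>"] intf
      by (auto simp: Z_def[abs_def] Q.prob_space[simplified] Q.prob_space)
    show "integrable M (\<lambda>\<omega>. (Z j \<omega>)\<^sup>2)" "expectation (\<lambda>\<omega>. (Z j \<omega>)\<^sup>2) \<le> v"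
      using Z[OF j int(2)] v by (auto simp: Z_def)
  qed simp
  have eq: "((\<Sum>j = 1..n. f (X j \<omega>)) / real n - \<mu>)\<^sup>2 = (\<Sum>i\<in>{1..n}. Z i \<omega>)\<^sup>2 / (real n)\<^sup>2" for \<omega>
    using n by (simp add: Z_def sum_subtractf power_divide[symmetric] diff_divide_distrib)
  show "integrable M (\<lambda>\<omega>. ((\<Sum>j = 1..n. f (X j \<omega>)) / real n - \<mu>)\<^sup>2)"
    unfolding eq using main by simp
  show "expectation (\<lambda>\<omega>. ((\<Sum>j = 1..n. f (X j \<omega>)) / real n - \<mu>)\<^sup>2) \<le> v / real n"
    unfolding eq using main n by (simp add: power2_eq_square field_simps)
qed

section \<open>A deterministic bound for the test statistic\<close>

definition kernel_average :: "real \<Rightarrow> nat \<Rightarrow> (nat \<Rightarrow> real) \<Rightarrow> real \<Rightarrow> real" where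
  "kernel_average a n x t = (\<Sum>j = 1..n. bessel_kernel a (t * x j)) / real n"

lemma kernel_average_measurable [measurable]: "kernel_average a n x \<in> borel_measurable borel"
  unfolding kernel_average_def[abs_def] by measurable

lemma abs_kernel_average_le_1:
  assumes "a \<ge> 1 / 2"
  shows "\<bar>kernel_average a n x t\<bar> \<le> 1"
proof -
  have "\<bar>\<Sum>j = 1..n. bessel_kernel a (t * x j)\<bar> \<le> (\<Sum>j = 1..n. 1)"
    using abs_bessel_kernel_le_1[OF assms] by (intro order_trans[OF sum_abs] sum_mono)
  then show ?thesis by (cases "n = 0") (simp_all add: kernel_average_def)
qed

text \<open>
  The Lipschitz bound makes the \<open>j\<close>-th difference at most a multiple of \<open>x j\<close>. These multiples add up to
  the sample mean \<open>m\<close>, and \<open>m\<close> times \<open>1 / m - 1 / a\<close> is \<open>(a - m) / a\<close>: the division by a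
  possibly small sample mean does no harm.
\<close>

lemma kernel_average_scaled_sample_diff_le:
  assumes a: "a \<ge> 1 / 2" and t: "t \<ge> 0" and n: "n > 0" and x: "\<And>j. j \<in> {1..n} \<Longrightarrow> x j \<ge> 0"
  shows "\<bar>kernel_average a n (scaled_sample n x) t - kernel_average a n (\<lambda>j. x j / a) t\<bar>
    \<le> t * \<bar>sample_mean n x - a\<bar> / a\<^sup>2"
proof (cases "sample_mean n x = 0")
  case True
  \<comment> \<open>a vanishing sample mean forces all observations to vanish, and \<open>scaled_sample\<close> is then \<open>0\<close> too\<close>
  then have "x j = 0" if "j \<in> {1..n}" for j
    using sum_nonneg_eq_0_iff[of "{1..n}" x] x n that by (simp add: sample_mean_def)
  then show ?thesis
    using True a t by (simp add: kernel_average_def scaled_sample_def)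
next
  case False
  define m where "m = sample_mean n x"
  have "m \<ge> 0"
    using sum_nonneg[of "{1..n}" x] x by (simp add: m_def sample_mean_def)
  then have m: "m > 0"
    using False by (simp add: m_def)
  have sum: "(\<Sum>j = 1..n. x j) = real n * m" using n by (simp add: m_def sample_mean_def)
  have "\<bar>kernel_average a n (scaled_sample n x) t - kernel_average a n (\<lambda>j. x j / a) t\<bar>
      = \<bar>\<Sum>j = 1..n. bessel_kernel a (t * (x j / m)) - bessel_kernel a (t * (x j / a))\<bar> / real n"
    using m by (simp add: kernel_average_def scaled_sample_def m_def sum_subtractf diff_divide_distrib[symmetric])
  also have "\<dots> \<le> (\<Sum>j = 1..n. t * \<bar>1 / m - 1 / a\<bar> / a * x j) / real n"
  proof (intro divide_right_mono order_trans[OF sum_abs] sum_mono)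
    fix j assume "j \<in> {1..n}"
    have "\<bar>bessel_kernel a (t * (x j / m)) - bessel_kernel a (t * (x j / a))\<bar>
        \<le> \<bar>t * (x j / m) - t * (x j / a)\<bar> / a"
      by (rule bessel_kernel_lipschitz[OF a])
    also have "t * (x j / m) - t * (x j / a) = (t * x j) * (1 / m - 1 / a)"
      by (simp add: algebra_simps)
    finally show "\<bar>bessel_kernel a (t * (x j / m)) - bessel_kernel a (t * (x j / a))\<bar>
        \<le> t * \<bar>1 / m - 1 / a\<bar> / a * x j"
      using t x[OF \<open>j \<in> {1..n}\<close>] by (simp add: abs_mult mult_ac)
  qed simp
  also have "\<dots> = t * (\<bar>1 / m - 1 / a\<bar> * m) / a"
    unfolding sum_distrib_left[symmetric] sum using n by simp
  also have "\<bar>1 / m - 1 / a\<bar> * m = \<bar>(1 / m - 1 / a) * m\<bar>"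
    using m by (simp add: abs_mult)
  also have "(1 / m - 1 / a) * m = (a - m) / a"
    using m a by (simp add: field_simps)
  finally show ?thesis
    using a by (simp add: m_def power2_eq_square abs_minus_commute)
qed

lemma T_statistic_eq:
  assumes a: "a \<ge> 1 / 2" and n: "n > 0" and x: "\<And>j. j \<in> {1..n} \<Longrightarrow> x j \<ge> 0"
  shows "T_statistic a n x / sqrt (real n)
    = sqrt (\<integral>t. (kernel_average a n (scaled_sample n x) t - exp (- t / a))\<^sup>2 \<partial>gamma_distribution a)"
proof -
  let ?G = "gamma_distribution a"
  have a0: "a > 0" using a by simp
  have y: "scaled_sample n x j \<ge> 0" if "j \<in> {1..n}" for j
    using x that by (auto simp: scaled_sample_def sample_mean_def intro!: divide_nonneg_nonneg sum_nonneg)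
  have "(\<integral>t. ((1 / real n) * (\<Sum>j = 1..n. hankel_kernel a (t * scaled_sample n x j)) - exp (- t / a))\<^sup>2 \<partial>?G)
      = (\<integral>t. (kernel_average a n (scaled_sample n x) t - exp (- t / a))\<^sup>2 \<partial>?G)"
  proof (intro integral_cong_AE)
    show "AE t in ?G. ((1 / real n) * (\<Sum>j = 1..n. hankel_kernel a (t * scaled_sample n x j)) - exp (- t / a))\<^sup>2
        = (kernel_average a n (scaled_sample n x) t - exp (- t / a))\<^sup>2"
      using AE_gamma_distribution_pos[OF a0]
    proof eventually_elim
      case (elim t)
      have "(\<Sum>j = 1..n. hankel_kernel a (t * scaled_sample n x j))
          = (\<Sum>j = 1..n. bessel_kernel a (t * scaled_sample n x j))"
        using elim y a0 by (intro sum.cong refl hankel_kernel_eq_bessel_kernel) auto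
      then show ?case by (simp add: kernel_average_def)
    qed
  qed auto
  then show ?thesis
    using n by (simp add: T_statistic_def T_squared_def real_sqrt_mult)
qed

text \<open>
  In the application \<open>m\<close> is the mean of the kernel average at the scale \<open>a\<close>, and then the second
  root is the limit of the statistic. The distance between the two functions of \<open>t\<close> is split at the kernel average at the scale
  \<open>a\<close> into the effect of estimating the scale and the effect of sampling. The constant \<open>(a + 1) / a ^ 3\<close>
  is the second moment \<open>a (a + 1)\<close> of the gamma distribution divided by \<open>a ^ 4\<close>.
\<close>

lemma T_statistic_deviation_le:
  fixes m :: "real \<Rightarrow> real"
  assumes a: "a \<ge> 1 / 2" and n: "n > 0" and x: "\<And>j. j \<in> {1..n} \<Longrightarrow> x j \<ge> 0"
    and m[measurable]: "m \<in> borel_measurable borel" and m_le: "\<And>t. \<bar>m t\<bar> \<le> 1"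
  shows "(T_statistic a n x / sqrt (real n) - sqrt (\<integral>t. (m t - exp (- t / a))\<^sup>2 \<partial>gamma_distribution a))\<^sup>2
    \<le> 2 * ((a + 1) / a ^ 3) * (sample_mean n x - a)\<^sup>2
      + 2 * (\<integral>t. (kernel_average a n (\<lambda>j. x j / a) t - m t)\<^sup>2 \<partial>gamma_distribution a)"
proof -
  let ?G = "gamma_distribution a"
  have a0: "a > 0" using a by simp
  interpret G: prob_space ?G by (rule prob_space_gamma_distribution[OF a0])
  let ?D = "kernel_average a n (scaled_sample n x)" and ?A = "kernel_average a n (\<lambda>j. x j / a)"
  note D_le = abs_kernel_average_le_1[OF a, of n "scaled_sample n x"]
  note A_le = abs_kernel_average_le_1[OF a, of n "\<lambda>j. x j / a"]
  have sq: "integrable ?G (\<lambda>t. (f t - g t)\<^sup>2)"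
    if [measurable]: "f \<in> borel_measurable borel" "g \<in> borel_measurable borel"
      and "AE t in ?G. \<bar>f t\<bar> \<le> 1" "AE t in ?G. \<bar>g t\<bar> \<le> 1" for f g :: "real \<Rightarrow> real"
  proof (rule G.integrable_const_bound[where B = 4])
    show "AE t in ?G. norm ((f t - g t)\<^sup>2) \<le> 4"
      using that(3,4)
    proof eventually_elim
      case (elim t)
      then have "\<bar>f t - g t\<bar> \<le> 2" by simp
      then have "(f t - g t)\<^sup>2 \<le> 2\<^sup>2" by (subst abs_le_square_iff[symmetric]) simp
      then show ?case by simp
    qed
  qed measurable
  have exp_le: "AE t in ?G. \<bar>exp (- t / a)\<bar> \<le> 1"
    using AE_gamma_distribution_pos[OF a0] by eventually_elim (use a0 in simp)
  have "(sqrt (\<integral>t. (?D t - exp (- t / a))\<^sup>2 \<partial>?G) - sqrt (\<integral>t. (m t - exp (- t / a))\<^sup>2 \<partial>?G))\<^sup>2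
      \<le> (\<integral>t. ((?D t - exp (- t / a)) - (m t - exp (- t / a)))\<^sup>2 \<partial>?G)"
    using D_le m_le exp_le by (intro sqrt_integral_square_diff_le sq) auto
  also have "\<dots> = (\<integral>t. (?D t - m t)\<^sup>2 \<partial>?G)" by simp
  also have "\<dots> \<le> (\<integral>t. 2 * ((?D t - ?A t)\<^sup>2 + (?A t - m t)\<^sup>2) \<partial>?G)"
  proof (intro integral_mono)
    show "(?D t - m t)\<^sup>2 \<le> 2 * ((?D t - ?A t)\<^sup>2 + (?A t - m t)\<^sup>2)" for t
      using sum_squares_bound[of "?D t - ?A t" "?A t - m t"] power2_sum[of "?D t - ?A t" "?A t - m t"]
      by simp
  qed (use D_le A_le m_le in \<open>auto intro!: sq integrable_mult_right Bochner_Integration.integrable_add\<close>)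
  also have "\<dots> = 2 * (\<integral>t. (?D t - ?A t)\<^sup>2 \<partial>?G) + 2 * (\<integral>t. (?A t - m t)\<^sup>2 \<partial>?G)"
    using sq[of ?D ?A] sq[of ?A m] D_le A_le m_le by simp
  also have "(\<integral>t. (?D t - ?A t)\<^sup>2 \<partial>?G) \<le> (\<integral>t. (sample_mean n x - a)\<^sup>2 / a ^ 4 * t ^ 2 \<partial>?G)"
  proof (intro integral_mono_AE)
    show "AE t in ?G. (?D t - ?A t)\<^sup>2 \<le> (sample_mean n x - a)\<^sup>2 / a ^ 4 * t ^ 2"
      using AE_gamma_distribution_pos[OF a0]
    proof eventually_elim
      case (elim t)
      have "(?D t - ?A t)\<^sup>2 \<le> (t * \<bar>sample_mean n x - a\<bar> / a\<^sup>2)\<^sup>2"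
        using kernel_average_scaled_sample_diff_le[OF a _ n x, of t] elim
        by (subst abs_le_square_iff[symmetric]) (simp_all add: abs_mult)
      then show ?case by (simp add: power_mult_distrib power_divide mult_ac flip: power_mult)
    qed
  qed (use D_le A_le in \<open>auto intro!: sq integrable_gamma_distribution_power[OF a0] integrable_mult_right\<close>)
  also have "(\<integral>t. (sample_mean n x - a)\<^sup>2 / a ^ 4 * t ^ 2 \<partial>?G)
      = (sample_mean n x - a)\<^sup>2 / a ^ 4 * (a * (a + 1))"
    using gamma_distribution_moment[OF a0, of 2]
    by (simp add: has_bochner_integral_iff pochhammer_rec numeral_2_eq_2)
  also have "\<dots> = (a + 1) / a ^ 3 * (sample_mean n x - a)\<^sup>2"
    using a0 by (simp add: field_simps power_numeral_reduce)
  finally show ?thesis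
    using T_statistic_eq[OF a n, of x] x by (simp add: algebra_simps)
qed

text \<open>
  This makes the event in the Wieand condition measurable; a non-measurable set would receive the
  default measure \<open>0\<close>.
\<close>

lemma T_statistic_measurable:
  assumes "a > 0" and X: "\<And>j. j \<in> {1..n} \<Longrightarrow> X j \<in> borel_measurable M"
  shows "(\<lambda>\<omega>. T_statistic a n (\<lambda>j. X j \<omega>)) \<in> borel_measurable M"
proof -
  let ?G = "gamma_distribution a"
  interpret prob_space ?G using assms(1) by (rule prob_space_gamma_distribution)
  have [measurable]: "(\<lambda>\<omega>. sample_mean n (\<lambda>j. X j \<omega>)) \<in> borel_measurable M"
    unfolding sample_mean_def using X by (intro borel_measurable_divide borel_measurable_sum) auto
  have y: "(\<lambda>\<omega>. scaled_sample n (\<lambda>j. X j \<omega>) j) \<in> borel_measurable M" if "j \<in> {1..n}" for j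
    unfolding scaled_sample_def using X[OF that] by measurable
  have "(\<lambda>p. \<Sum>j = 1..n. hankel_kernel a (snd p * scaled_sample n (\<lambda>j. X j (fst p)) j))
      \<in> borel_measurable (M \<Otimes>\<^sub>M ?G)"
  proof (rule borel_measurable_sum)
    fix j assume "j \<in> {1..n}"
    note [measurable] = y[OF this]
    show "(\<lambda>p. hankel_kernel a (snd p * scaled_sample n (\<lambda>j. X j (fst p)) j)) \<in> borel_measurable (M \<Otimes>\<^sub>M ?G)"
      by measurable
  qed
  then have [measurable]: "(\<lambda>(\<omega>, t). \<Sum>j = 1..n. hankel_kernel a (t * scaled_sample n (\<lambda>j. X j \<omega>) j))
      \<in> borel_measurable (M \<Otimes>\<^sub>M ?G)"
    by (simp add: case_prod_beta')
  show ?thesis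
    unfolding T_statistic_def T_squared_def by measurable
qed

section \<open>Concentration of the test statistic\<close>

text \<open>
  Both terms of \<open>T_statistic_deviation_le\<close> have expectation of order \<open>1 / n\<close>: the first is the variance of
  the sample mean, the second is for each \<open>t\<close> the variance of an average of independent variables bounded
  by \<open>1\<close>, integrated over \<open>t\<close> by Fubini's theorem. Markov's inequality for the squared deviation
  concludes. The constant involves \<open>Q\<close> only through the bound \<open>V\<close> on its variance.
\<close>

lemma T_statistic_concentration:
  fixes X :: "nat \<Rightarrow> 'w \<Rightarrow> real"
  assumes a: "a \<ge> 1 / 2" and n: "n > 0" and "prob_space M"
    and ind: "prob_space.indep_vars M (\<lambda>_. borel) X {1..}"
    and Q: "\<And>j. j \<ge> 1 \<Longrightarrow> distr M borel (X j) = Q"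
    and pos: "AE x in Q. x \<ge> 0"
    and mean: "has_bochner_integral Q (\<lambda>x. x) a"
    and var: "integrable Q (\<lambda>x. (x - a)\<^sup>2)" "(\<integral>x. (x - a)\<^sup>2 \<partial>Q) \<le> V"
    and b: "b = sqrt (\<integral>t. ((\<integral>x. bessel_kernel a (t * x / a) \<partial>Q) - exp (- t / a))\<^sup>2 \<partial>gamma_distribution a)"
    and d: "d > 0"
  shows "measure M {\<omega> \<in> space M. \<bar>T_statistic a n (\<lambda>j. X j \<omega>) / sqrt (real n) - b\<bar> < d}
    \<ge> 1 - (2 * ((a + 1) / a ^ 3) * V + 2) / (real n * d\<^sup>2)"
proof -
  let ?G = "gamma_distribution a"
  have a0: "a > 0" using a by simp
  interpret G: prob_space ?G by (rule prob_space_gamma_distribution[OF a0])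
  interpret M: prob_space M by fact
  interpret MG: pair_sigma_finite M ?G ..
  have X[measurable]: "X j \<in> borel_measurable M" if "j \<ge> 1" for j
    using ind that by (auto simp: M.indep_vars_def)
  have sQ[measurable_cong, simp]: "sets Q = sets borel" using Q[of 1, symmetric] by simp
  interpret Q: prob_space Q
    using M.prob_space_distr[OF X[of 1]] Q[of 1] by simp
  define m where "m t = (\<integral>x. bessel_kernel a (t * x / a) \<partial>Q)" for t
  define W where "W \<omega> = (\<integral>t. (kernel_average a n (\<lambda>j. X j \<omega> / a) t - m t)\<^sup>2 \<partial>?G)" for \<omega>
  define U where "U \<omega> = (sample_mean n (\<lambda>j. X j \<omega>) - a)\<^sup>2" for \<omega>
  define c where "c = (a + 1) / a ^ 3"
  have c: "c \<ge> 0" using a0 by (simp add: c_def)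
  have kq: "integrable Q (\<lambda>x. bessel_kernel a (t * x / a))" for t
    using abs_bessel_kernel_le_1[OF a] by (intro Q.integrable_const_bound[where B = 1]) auto
  have m[measurable]: "m \<in> borel_measurable borel"
    unfolding m_def[abs_def] by measurable
  have m_le: "\<bar>m t\<bar> \<le> 1" for t
  proof -
    have "\<bar>m t\<bar> \<le> (\<integral>x. \<bar>bessel_kernel a (t * x / a)\<bar> \<partial>Q)"
      unfolding m_def by (rule integral_abs_bound)
    also have "\<dots> \<le> (\<integral>x. 1 \<partial>Q)"
      using kq abs_bessel_kernel_le_1[OF a] by (intro integral_mono integrable_abs) auto
    finally show ?thesis by (simp add: Q.prob_space)
  qed
  have diff_le: "(u - v)\<^sup>2 \<le> 4" if "\<bar>u\<bar> \<le> 1" "\<bar>v\<bar> \<le> 1" for u v :: real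
  proof -
    have "\<bar>u - v\<bar> \<le> \<bar>2\<bar>" using that by simp
    then show ?thesis by (subst (asm) abs_le_square_iff) simp
  qed
  have kq2: "integrable Q (\<lambda>x. (bessel_kernel a (t * x / a) - m t)\<^sup>2)" for t
    using diff_le[OF abs_bessel_kernel_le_1[OF a] m_le]
    by (intro Q.integrable_const_bound[where B = 4]) auto
  have kvar: "(\<integral>x. (bessel_kernel a (t * x / a) - m t)\<^sup>2 \<partial>Q) \<le> 1" for t
  proof -
    have i2: "integrable Q (\<lambda>x. (bessel_kernel a (t * x / a))\<^sup>2)"
      using abs_bessel_kernel_le_1[OF a]
      by (intro Q.integrable_const_bound[where B = 1]) (auto simp: abs_square_le_1)
    have "(\<integral>x. (bessel_kernel a (t * x / a) - m t)\<^sup>2 \<partial>Q)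
        = (\<integral>x. (bessel_kernel a (t * x / a))\<^sup>2 \<partial>Q) - (m t)\<^sup>2"
      unfolding m_def using kq i2 by (rule Q.variance_eq)
    also have "\<dots> \<le> (\<integral>x. (bessel_kernel a (t * x / a))\<^sup>2 \<partial>Q)" by simp
    also have "\<dots> \<le> (\<integral>x. 1 \<partial>Q)"
      using i2 abs_bessel_kernel_le_1[OF a] by (intro integral_mono) (auto simp: abs_square_le_1)
    finally show ?thesis by (simp add: Q.prob_space)
  qed
  \<comment> \<open>the form in which the general bound for sample averages applies\<close>
  have avg: "kernel_average a n (\<lambda>j. X j \<omega> / a) t = (\<Sum>j = 1..n. bessel_kernel a (t * X j \<omega> / a)) / real n"
    for \<omega> t by (simp add: kernel_average_def)
  have A_var: "M.expectation (\<lambda>\<omega>. (kernel_average a n (\<lambda>j. X j \<omega> / a) t - m t)\<^sup>2) \<le> 1 / real n" for t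
    unfolding avg
    by (rule M.sample_average_mean_square(2)[OF ind Q _ _ kq2 kvar n])
      (use kq in \<open>auto simp: m_def has_bochner_integral_iff\<close>)
  have "(\<lambda>p. \<Sum>j = 1..n. bessel_kernel a (snd p * X j (fst p) / a)) \<in> borel_measurable (M \<Otimes>\<^sub>M ?G)"
  proof (rule borel_measurable_sum)
    fix j assume "j \<in> {1..n}"
    then have [measurable]: "X j \<in> borel_measurable M" by simp
    show "(\<lambda>p. bessel_kernel a (snd p * X j (fst p) / a)) \<in> borel_measurable (M \<Otimes>\<^sub>M ?G)"
      by measurable
  qed
  then have [measurable]: "(\<lambda>(\<omega>, t). kernel_average a n (\<lambda>j. X j \<omega> / a) t) \<in> borel_measurable (M \<Otimes>\<^sub>M ?G)"
    unfolding avg by (simp add: case_prod_beta')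
  have A_int: "integrable (M \<Otimes>\<^sub>M ?G) (\<lambda>(\<omega>, t). (kernel_average a n (\<lambda>j. X j \<omega> / a) t - m t)\<^sup>2)"
  proof -
    interpret MGp: pair_prob_space M ?G ..
    show ?thesis
      using diff_le[OF abs_kernel_average_le_1[OF a] m_le]
      by (intro MGp.integrable_const_bound[where B = 4]) (auto simp: case_prod_beta)
  qed
  have W: "integrable M W" "M.expectation W \<le> 1 / real n"
  proof -
    show "integrable M W"
      unfolding W_def[abs_def] using MG.integrable_fst'[OF A_int] by simp
    have "M.expectation W
        = (\<integral>t. M.expectation (\<lambda>\<omega>. (kernel_average a n (\<lambda>j. X j \<omega> / a) t - m t)\<^sup>2) \<partial>?G)"
      unfolding W_def using MG.Fubini_integral[OF A_int] by simp
    also have "\<dots> \<le> (\<integral>t. 1 / real n \<partial>?G)"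
      using MG.integrable_snd[OF A_int] A_var by (intro integral_mono) auto
    finally show "M.expectation W \<le> 1 / real n" by (simp add: G.prob_space[simplified])
  qed
  have U: "integrable M U" "M.expectation U \<le> V / real n"
    using M.sample_average_mean_square[OF ind Q _ mean var n]
    by (auto simp: U_def[abs_def] sample_mean_def)
  define Z where "Z \<omega> = 2 * c * U \<omega> + 2 * W \<omega>" for \<omega>
  have Z: "integrable M Z" "M.expectation Z \<le> (2 * c * V + 2) / real n"
  proof -
    show "integrable M Z" using U W by (simp add: Z_def[abs_def])
    have "M.expectation Z = 2 * c * M.expectation U + 2 * M.expectation W"
      using U W by (simp add: Z_def[abs_def])
    also have "\<dots> \<le> 2 * c * (V / real n) + 2 * (1 / real n)"
      using U W c by (intro add_mono mult_left_mono) auto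
    finally show "M.expectation Z \<le> (2 * c * V + 2) / real n" by (simp add: add_divide_distrib)
  qed
  have Z_nonneg: "Z \<omega> \<ge> 0" for \<omega>
    using c by (simp add: Z_def U_def W_def)
  have pos': "AE \<omega> in M. \<forall>j\<in>{1..n}. X j \<omega> \<ge> 0"
  proof (rule AE_finite_allI)
    fix j assume "j \<in> {1..n}"
    then have j: "j \<ge> 1" by simp
    show "AE \<omega> in M. X j \<omega> \<ge> 0"
      using pos unfolding Q[OF j, symmetric] by (subst (asm) AE_distr_iff) (use X[OF j] in auto)
  qed simp
  define S where "S \<omega> = T_statistic a n (\<lambda>j. X j \<omega>) / sqrt (real n) - b" for \<omega>
  have S[measurable]: "S \<in> borel_measurable M"
    unfolding S_def[abs_def]
    by (intro borel_measurable_diff borel_measurable_divide T_statistic_measurable a0) auto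
  have dev: "AE \<omega> in M. (S \<omega>)\<^sup>2 \<le> Z \<omega>"
    using pos'
  proof eventually_elim
    case (elim \<omega>)
    then show ?case
      using T_statistic_deviation_le[OF a n, of "\<lambda>j. X j \<omega>" m] m_le
      by (simp add: S_def Z_def U_def W_def b c_def m_def[symmetric])
  qed
  have "M.prob {\<omega> \<in> space M. \<not> \<bar>S \<omega>\<bar> < d} \<le> M.prob {\<omega> \<in> space M. Z \<omega> \<ge> d\<^sup>2}"
  proof (rule M.finite_measure_mono_AE)
    show "AE \<omega> in M. \<omega> \<in> {\<omega> \<in> space M. \<not> \<bar>S \<omega>\<bar> < d} \<longrightarrow> \<omega> \<in> {\<omega> \<in> space M. Z \<omega> \<ge> d\<^sup>2}"
      using dev
    proof eventually_elim
      case (elim \<omega>)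
      have "d\<^sup>2 \<le> (S \<omega>)\<^sup>2" if "\<not> \<bar>S \<omega>\<bar> < d"
        using that d by (subst abs_le_square_iff[symmetric]) simp
      then show ?case using elim by auto
    qed
    show "{\<omega> \<in> space M. Z \<omega> \<ge> d\<^sup>2} \<in> sets M"
      using Z(1) by measurable
  qed
  also have "\<dots> \<le> M.expectation Z / d\<^sup>2"
    using Z(1) Z_nonneg d by (intro integral_Markov_inequality_measure[where A = "space M"]) auto
  also have "\<dots> \<le> (2 * c * V + 2) / real n / d\<^sup>2"
    using Z(2) d by (intro divide_right_mono) auto
  finally have "M.prob {\<omega> \<in> space M. \<not> \<bar>S \<omega>\<bar> < d} \<le> (2 * c * V + 2) / (real n * d\<^sup>2)"
    by simp
  moreover have "M.prob {\<omega> \<in> space M. \<not> \<bar>S \<omega>\<bar> < d} = 1 - M.prob {\<omega> \<in> space M. \<bar>S \<omega>\<bar> < d}"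
    by (rule M.prob_neg) measurable
  ultimately show ?thesis
    by (simp add: S_def c_def)
qed

section \<open>Positivity of the limit\<close>

lemma hankel_integral_eq:
  assumes a: "a > 0" and g[measurable]: "g \<in> borel_measurable borel" and t: "t > 0"
  shows "(\<integral>x. hankel_kernel a (t * x / a) * g x \<partial>gamma_distribution a)
    = (\<integral>x. bessel_kernel a (t * x / a) * g x \<partial>gamma_distribution a)"
proof (rule integral_cong_AE)
  show "(\<lambda>x. hankel_kernel a (t * x / a) * g x) \<in> borel_measurable (gamma_distribution a)"
    by measurable
  show "AE x in gamma_distribution a. hankel_kernel a (t * x / a) * g x = bessel_kernel a (t * x / a) * g x"
    using AE_gamma_distribution_pos[OF a]
    by eventually_elim (use t a in \<open>simp add: hankel_kernel_eq_bessel_kernel\<close>)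
qed measurable

lemma wieand_b_eq:
  assumes a: "a > 0" and [measurable]: "h \<theta> \<in> borel_measurable borel"
  shows "wieand_b a h \<theta>
    = sqrt (\<integral>t. (\<integral>x. bessel_kernel a (t * x / a) * (\<theta> * h \<theta> x) \<partial>gamma_distribution a)\<^sup>2 \<partial>gamma_distribution a)"
proof -
  let ?G = "gamma_distribution a"
  interpret G: prob_space ?G by (rule prob_space_gamma_distribution[OF a])
  have eq: "\<theta>\<^sup>2 * (\<integral>t. (\<integral>x. hankel_kernel a (t * x / a) * h \<theta> x \<partial>?G)\<^sup>2 \<partial>?G)
      = (\<integral>t. (\<integral>x. \<theta> * (hankel_kernel a (t * x / a) * h \<theta> x) \<partial>?G)\<^sup>2 \<partial>?G)"
    by (simp add: power_mult_distrib)
  show ?thesis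
    unfolding wieand_b_def eq
  proof (intro arg_cong[where f = sqrt] integral_cong_AE)
    show "AE t in ?G. (\<integral>x. \<theta> * (hankel_kernel a (t * x / a) * h \<theta> x) \<partial>?G)\<^sup>2
        = (\<integral>x. bessel_kernel a (t * x / a) * (\<theta> * h \<theta> x) \<partial>?G)\<^sup>2"
      using AE_gamma_distribution_pos[OF a]
    proof eventually_elim
      case (elim t)
      then show ?case
        using hankel_integral_eq[OF a _ elim, of "\<lambda>x. \<theta> * h \<theta> x"] by (auto simp: mult_ac)
    qed
  qed measurable
qed

text \<open>
  The term \<open>1\<close> of the density \<open>1 + g\<close> contributes the Hankel transform of the gamma distribution
  itself, which is the exponential in the statistic.
\<close>

lemma kernel_mean_diff_eq:
  assumes a: "a \<ge> 1 / 2" and g: "integrable (gamma_distribution a) g"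
    and nonneg: "AE x in gamma_distribution a. 1 + g x \<ge> 0" and t: "t \<ge> 0"
  shows "(\<integral>x. bessel_kernel a (t * x / a) \<partial>density (gamma_distribution a) (\<lambda>x. ennreal (1 + g x))) - exp (- t / a)
    = (\<integral>x. bessel_kernel a (t * x / a) * g x \<partial>gamma_distribution a)"
proof -
  let ?G = "gamma_distribution a"
  have a0: "a > 0" using a by simp
  interpret G: prob_space ?G by (rule prob_space_gamma_distribution[OF a0])
  have [measurable]: "g \<in> borel_measurable borel" using g by (auto dest: borel_measurable_integrable)
  have k1: "integrable ?G (\<lambda>x. bessel_kernel a (t * x / a))"
    using abs_bessel_kernel_le_1[OF a] by (intro G.integrable_const_bound[where B = 1]) auto
  have k2: "integrable ?G (\<lambda>x. bessel_kernel a (t * x / a) * g x)"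
    using abs_bessel_kernel_le_1[OF a]
    by (intro Bochner_Integration.integrable_bound[OF g]) (auto simp: abs_mult mult_left_le_one_le)
  have "(\<integral>x. bessel_kernel a (t * x / a) \<partial>density ?G (\<lambda>x. ennreal (1 + g x)))
      = (\<integral>x. bessel_kernel a (t * x / a) + bessel_kernel a (t * x / a) * g x \<partial>?G)"
    using nonneg by (subst integral_density) (auto simp: algebra_simps)
  also have "\<dots> = (\<integral>x. bessel_kernel a (t / a * x) \<partial>?G) + (\<integral>x. bessel_kernel a (t * x / a) * g x \<partial>?G)"
    using k1 k2 by simp
  also have "(\<integral>x. bessel_kernel a (t / a * x) \<partial>?G) = exp (- (t / a))"
    using a0 t by (intro bessel_kernel_hankel_transform) auto
  finally show ?thesis by simp
qed

text \<open>
  If the limit vanished, so would the Hankel transform of the perturbation \<open>\<theta> h\<close>, and by injectivity the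
  alternative would coincide with the null hypothesis.
\<close>

lemma wieand_b_pos:
  assumes a: "a \<ge> 1 / 2" and h: "has_bochner_integral (gamma_distribution a) (h \<theta>) 0"
    and nonneg: "AE x in gamma_distribution a. 1 + \<theta> * h \<theta> x \<ge> 0"
    and ne: "density (gamma_distribution a) (\<lambda>x. ennreal (1 + \<theta> * h \<theta> x)) \<noteq> gamma_distribution a"
  shows "wieand_b a h \<theta> > 0"
proof (rule ccontr)
  let ?G = "gamma_distribution a"
  have a0: "a > 0" using a by simp
  interpret G: prob_space ?G by (rule prob_space_gamma_distribution[OF a0])
  have g: "has_bochner_integral ?G (\<lambda>x. \<theta> * h \<theta> x) 0"
    using has_bochner_integral_mult_right[OF h, of \<theta>] by simp
  then have int: "integrable ?G (\<lambda>x. \<theta> * h \<theta> x)"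
    by (auto simp: has_bochner_integral_iff)
  have [measurable]: "h \<theta> \<in> borel_measurable borel"
    using h by (auto simp: has_bochner_integral_iff dest: borel_measurable_integrable)
  define H where "H t = (\<integral>x. bessel_kernel a (t * x / a) * (\<theta> * h \<theta> x) \<partial>?G)" for t
  have [measurable]: "H \<in> borel_measurable borel"
    unfolding H_def[abs_def] by measurable
  have kint: "integrable ?G (\<lambda>x. bessel_kernel a (t * x / a) * (\<theta> * h \<theta> x))" for t
    using abs_bessel_kernel_le_1[OF a]
    by (intro Bochner_Integration.integrable_bound[OF int]) (auto simp: abs_mult mult_left_le_one_le)
  have H_le: "\<bar>H t\<bar> \<le> (\<integral>x. \<bar>\<theta> * h \<theta> x\<bar> \<partial>?G)" for t
  proof -
    have "\<bar>H t\<bar> \<le> (\<integral>x. \<bar>bessel_kernel a (t * x / a) * (\<theta> * h \<theta> x)\<bar> \<partial>?G)"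
      unfolding H_def by (rule integral_abs_bound)
    also have "\<dots> \<le> (\<integral>x. \<bar>\<theta> * h \<theta> x\<bar> \<partial>?G)"
      using abs_bessel_kernel_le_1[OF a]
      by (intro integral_mono integrable_abs kint int) (simp add: abs_mult mult_left_le_one_le)
    finally show ?thesis .
  qed
  have H2: "integrable ?G (\<lambda>t. (H t)\<^sup>2)"
  proof (rule G.integrable_const_bound[where B = "(\<integral>x. \<bar>\<theta> * h \<theta> x\<bar> \<partial>?G)\<^sup>2"])
    have "(H t)\<^sup>2 \<le> (\<integral>x. \<bar>\<theta> * h \<theta> x\<bar> \<partial>?G)\<^sup>2" for t
      using order_trans[OF H_le abs_ge_self] by (subst abs_le_square_iff[symmetric])
    then show "AE t in ?G. norm ((H t)\<^sup>2) \<le> (\<integral>x. \<bar>\<theta> * h \<theta> x\<bar> \<partial>?G)\<^sup>2" by simp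
  qed measurable
  assume "\<not> wieand_b a h \<theta> > 0"
  then have "(\<integral>t. (H t)\<^sup>2 \<partial>?G) \<le> 0"
    unfolding wieand_b_eq[OF a0] H_def by (subst (asm) wieand_b_eq[OF a0]) auto
  then have "(\<integral>t. (H t)\<^sup>2 \<partial>?G) = 0"
    by (intro antisym) auto
  then have "AE t in ?G. H t = 0"
    using H2 by (simp add: integral_nonneg_eq_0_iff_AE)
  then show False
    using hankel_transform_injective[OF a a0 g nonneg] ne by (simp add: H_def)
qed

section \<open>Uniform second moments near the null hypothesis\<close>

lemma integrable_gamma_distribution_shifted_power:
  assumes "a > 0"
  shows "integrable (gamma_distribution a) (\<lambda>x. (x - c) ^ k)"
proof -
  have "(\<lambda>x. (x - c) ^ k) = (\<lambda>x :: real. \<Sum>i\<le>k. of_nat (k choose i) * x ^ i * (- c) ^ (k - i))"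
    using binomial_ring[of _ "- c" k] by auto
  then show ?thesis
    by (auto intro!: integrable_gamma_distribution_power assms Bochner_Integration.integrable_sum)
qed

text \<open>
  The product \<open>(x - a)\<^sup>2 g x\<close> is at most \<open>(x - a) ^ 4 + (g x)\<^sup>2\<close>, so an \<open>L\<^sup>2\<close> bound on the
  perturbation \<open>g\<close> is enough.
\<close>

lemma tilted_gamma_variance_le:
  assumes a: "a > 0" and g[measurable]: "g \<in> borel_measurable borel"
    and g2: "integrable (gamma_distribution a) (\<lambda>x. (g x)\<^sup>2)"
    and nonneg: "AE x in gamma_distribution a. 1 + g x \<ge> 0"
  shows "integrable (density (gamma_distribution a) (\<lambda>x. ennreal (1 + g x))) (\<lambda>x. (x - a)\<^sup>2)" (is ?int)
    and "(\<integral>x. (x - a)\<^sup>2 \<partial>density (gamma_distribution a) (\<lambda>x. ennreal (1 + g x)))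
      \<le> (\<integral>x. (x - a)\<^sup>2 + (x - a) ^ 4 \<partial>gamma_distribution a) + (\<integral>x. (g x)\<^sup>2 \<partial>gamma_distribution a)" (is ?le)
proof -
  let ?G = "gamma_distribution a"
  note p = integrable_gamma_distribution_shifted_power[OF a]
  have "integrable ?G (\<lambda>x. (x - a)\<^sup>2 * g x)"
    using p[of a 4] g2 by (intro integrable_mult_of_square_integrable) (auto simp flip: power_mult)
  then have i: "integrable ?G (\<lambda>x. (1 + g x) * (x - a)\<^sup>2)"
    using p[of a 2] by (simp add: algebra_simps)
  show ?int
    using i nonneg by (subst integrable_density) auto
  have "(\<integral>x. (x - a)\<^sup>2 \<partial>density ?G (\<lambda>x. ennreal (1 + g x))) = (\<integral>x. (1 + g x) * (x - a)\<^sup>2 \<partial>?G)"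
    using nonneg by (subst integral_density) auto
  also have "\<dots> \<le> (\<integral>x. ((x - a)\<^sup>2 + (x - a) ^ 4) + (g x)\<^sup>2 \<partial>?G)"
  proof (rule integral_mono[OF i])
    fix x
    have "(1 + v) * u \<le> (u + u\<^sup>2) + v\<^sup>2" for u v :: real
    proof -
      have "0 \<le> (u - v)\<^sup>2 + u\<^sup>2 + v\<^sup>2" by simp
      then show ?thesis by (simp add: power2_eq_square algebra_simps)
    qed
    from this[of "g x" "(x - a)\<^sup>2"] show "(1 + g x) * (x - a)\<^sup>2 \<le> ((x - a)\<^sup>2 + (x - a) ^ 4) + (g x)\<^sup>2"
      by (simp flip: power_mult)
  qed (use p[of a 2] p[of a 4] g2 in auto)
  also have "\<dots> = (\<integral>x. (x - a)\<^sup>2 + (x - a) ^ 4 \<partial>?G) + (\<integral>x. (g x)\<^sup>2 \<partial>?G)"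
    using p[of a 2] p[of a 4] g2 by simp
  finally show ?le .
qed

lemma square_integrable_of_L2_close:
  fixes f g :: "'a \<Rightarrow> real"
  assumes [measurable]: "f \<in> borel_measurable M" "g \<in> borel_measurable M"
    and g: "integrable M (\<lambda>x. (g x)\<^sup>2)" and le: "(\<integral>\<^sup>+x. ennreal ((f x - g x)\<^sup>2) \<partial>M) \<le> 1"
  shows "integrable M (\<lambda>x. (f x)\<^sup>2)" and "(\<integral>x. (f x)\<^sup>2 \<partial>M) \<le> 2 * (\<integral>x. (g x)\<^sup>2 \<partial>M) + 2"
proof -
  have d: "integrable M (\<lambda>x. (f x - g x)\<^sup>2)"
    using le by (intro integrableI_bounded) (auto simp: order.strict_trans1)
  then have "ennreal (\<integral>x. (f x - g x)\<^sup>2 \<partial>M) \<le> ennreal 1"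
    using le by (subst nn_integral_eq_integral[symmetric]) auto
  then have d1: "(\<integral>x. (f x - g x)\<^sup>2 \<partial>M) \<le> 1" by (subst (asm) ennreal_le_iff) auto
  have pw: "(f x)\<^sup>2 \<le> 2 * (g x)\<^sup>2 + 2 * (f x - g x)\<^sup>2" for x
    using sum_squares_bound[of "g x" "f x - g x"] power2_sum[of "g x" "f x - g x"] by simp
  have s: "integrable M (\<lambda>x. 2 * (g x)\<^sup>2 + 2 * (f x - g x)\<^sup>2)"
    using d g by simp
  show f2: "integrable M (\<lambda>x. (f x)\<^sup>2)"
    by (rule Bochner_Integration.integrable_bound[OF s]) (use pw in \<open>auto intro: order_trans[OF _ abs_ge_self]\<close>)
  have "(\<integral>x. (f x)\<^sup>2 \<partial>M) \<le> (\<integral>x. 2 * (g x)\<^sup>2 + 2 * (f x - g x)\<^sup>2 \<partial>M)"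
    by (rule integral_mono[OF f2 s pw])
  also have "\<dots> = 2 * (\<integral>x. (g x)\<^sup>2 \<partial>M) + 2 * (\<integral>x. (f x - g x)\<^sup>2 \<partial>M)"
    using d g by simp
  finally show "(\<integral>x. (f x)\<^sup>2 \<partial>M) \<le> 2 * (\<integral>x. (g x)\<^sup>2 \<partial>M) + 2" using d1 by simp
qed

section \<open>The Wieand condition\<close>

theorem theorem5p2:
  fixes \<alpha> \<eta> :: real
    and P :: "real \<Rightarrow> real measure"
    and h :: "real \<Rightarrow> real \<Rightarrow> real"
    and h0 :: "real \<Rightarrow> real"
    and M :: "real \<Rightarrow> 'w measure"
    and X :: "nat \<Rightarrow> 'w \<Rightarrow> real"
  defines "\<Theta> \<equiv> {-\<eta><..<\<eta>}"
  defines "\<Theta>\<^sub>1 \<equiv> \<Theta> - {0}"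
  assumes "\<alpha> \<ge> 1 / 2" and "\<eta> > 0"
    and "\<And>\<theta>. \<theta> \<in> \<Theta> \<Longrightarrow> prob_space (P \<theta>)"
    and "P 0 = gamma_distribution \<alpha>"
    and "\<And>\<theta>. \<theta> \<in> \<Theta>\<^sub>1 \<Longrightarrow> P \<theta> \<noteq> P 0"
    and "\<And>\<theta>. \<theta> \<in> \<Theta>\<^sub>1 \<Longrightarrow> has_bochner_integral (P 0) (h \<theta>) 0"
    and "\<And>\<theta>. \<theta> \<in> \<Theta>\<^sub>1 \<Longrightarrow> has_bochner_integral (P 0) (\<lambda>x. x * h \<theta> x) 0"
    and "\<And>\<theta>. \<theta> \<in> \<Theta>\<^sub>1 \<Longrightarrow> AE x in P 0. 1 + \<theta> * h \<theta> x \<ge> 0"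
    and "\<And>\<theta>. \<theta> \<in> \<Theta>\<^sub>1 \<Longrightarrow> P \<theta> = density (P 0) (\<lambda>x. ennreal (1 + \<theta> * h \<theta> x))"
    and "h0 \<in> borel_measurable (P 0)" and "integrable (P 0) (\<lambda>x. (h0 x)\<^sup>2)"
    and "((\<lambda>\<theta>. \<integral>\<^sup>+x. ennreal ((h \<theta> x - h0 x)\<^sup>2) \<partial>P 0) \<longlongrightarrow> 0) (at 0)"
    and "\<And>\<theta>. \<theta> \<in> \<Theta>\<^sub>1 \<Longrightarrow> prob_space (M \<theta>)"
    and "\<And>\<theta>. \<theta> \<in> \<Theta>\<^sub>1 \<Longrightarrow> prob_space.indep_vars (M \<theta>) (\<lambda>_. borel) X {1..}"
    and "\<And>\<theta> j. \<theta> \<in> \<Theta>\<^sub>1 \<Longrightarrow> j \<ge> 1 \<Longrightarrow> distr (M \<theta>) borel (X j) = P \<theta>"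
  shows "wieand_condition \<Theta>\<^sub>1 M (\<lambda>n \<omega>. T_statistic \<alpha> n (\<lambda>j. X j \<omega>)) (wieand_b \<alpha> h)"
proof -
  let ?G = "gamma_distribution \<alpha>"
  have a0: "\<alpha> > 0" using assms(3) by simp
  \<comment> \<open>for \<open>\<theta>\<close> near \<open>0\<close>, \<open>h \<theta>\<close> has distance at most \<open>1\<close> from \<open>h0\<close>, hence bounded \<open>L\<^sup>2\<close> norm\<close>
  have "eventually (\<lambda>\<theta>. (\<integral>\<^sup>+x. ennreal ((h \<theta> x - h0 x)\<^sup>2) \<partial>?G) < 1) (at 0)"
    using assms(14) unfolding assms(6) by (rule order_tendstoD) simp
  then obtain \<delta> where \<delta>: "\<delta> > 0"
    and close: "\<And>\<theta>. \<theta> \<noteq> 0 \<Longrightarrow> \<bar>\<theta>\<bar> < \<delta> \<Longrightarrow> (\<integral>\<^sup>+x. ennreal ((h \<theta> x - h0 x)\<^sup>2) \<partial>?G) < 1"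
    unfolding eventually_at by (auto simp: dist_real_def)
  \<comment> \<open>an upper bound for the variance that serves all \<open>\<theta>\<close> with \<open>\<bar>\<theta>\<bar> < min \<delta> 1\<close>\<close>
  define V where "V = (\<integral>x. (x - \<alpha>)\<^sup>2 + (x - \<alpha>) ^ 4 \<partial>?G) + (2 * (\<integral>x. (h0 x)\<^sup>2 \<partial>?G) + 2)"
  define K where "K = 2 * ((\<alpha> + 1) / \<alpha> ^ 3) * V + 2"
  have "(\<integral>x. (x - \<alpha>)\<^sup>2 + (x - \<alpha>) ^ 4 \<partial>?G) \<ge> 0"
    by (intro integral_nonneg_AE AE_I2 add_nonneg_nonneg) auto
  then have "V \<ge> 0" by (simp add: V_def)
  then have K: "K > 0" using a0 by (auto simp: K_def intro!: add_nonneg_pos mult_nonneg_nonneg)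
  show ?thesis
    unfolding wieand_condition_def
  proof (rule exI[of _ "min \<delta> 1"], intro conjI allI impI)
    fix \<epsilon> \<gamma> :: real assume \<epsilon>: "\<epsilon> > 0" and \<gamma>: "0 < \<gamma> \<and> \<gamma> < 1"
    \<comment> \<open>\<open>T_statistic_concentration\<close> with \<open>d = \<epsilon> b\<close> bounds the failure probability by \<open>K / (n \<epsilon>\<^sup>2 b\<^sup>2)\<close>\<close>
    show "\<exists>C>0. \<forall>\<theta>\<in>\<Theta>\<^sub>1 \<inter> {- min \<delta> 1<..<min \<delta> 1}. \<forall>n. C / (wieand_b \<alpha> h \<theta>)\<^sup>2 < real n \<longrightarrow>
        1 - \<gamma> < measure (M \<theta>) {\<omega> \<in> space (M \<theta>).
          \<bar>T_statistic \<alpha> n (\<lambda>j. X j \<omega>) / sqrt (real n) - wieand_b \<alpha> h \<theta>\<bar> < \<epsilon> * wieand_b \<alpha> h \<theta>}"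
    proof (intro exI[of _ "K / (\<epsilon>\<^sup>2 * \<gamma>)"] conjI ballI allI impI)
      show "K / (\<epsilon>\<^sup>2 * \<gamma>) > 0" using K \<epsilon> \<gamma> by simp
      fix \<theta> and n :: nat
      assume "\<theta> \<in> \<Theta>\<^sub>1 \<inter> {- min \<delta> 1<..<min \<delta> 1}"
        and n: "K / (\<epsilon>\<^sup>2 * \<gamma>) / (wieand_b \<alpha> h \<theta>)\<^sup>2 < real n"
      then have \<theta>: "\<theta> \<in> \<Theta>\<^sub>1" "\<theta> \<noteq> 0" "\<bar>\<theta>\<bar> < \<delta>" "\<bar>\<theta>\<bar> \<le> 1"
        by (auto simp: \<Theta>\<^sub>1_def)
      let ?b = "wieand_b \<alpha> h \<theta>"
      let ?Q = "density ?G (\<lambda>x. ennreal (1 + \<theta> * h \<theta> x))"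
      have h: "has_bochner_integral ?G (h \<theta>) 0" "has_bochner_integral ?G (\<lambda>x. x * h \<theta> x) 0"
        and nonneg: "AE x in ?G. 1 + \<theta> * h \<theta> x \<ge> 0" and P: "P \<theta> = ?Q"
        using assms(8-11)[OF \<theta>(1)] unfolding assms(6) by auto
      have hm[measurable]: "h \<theta> \<in> borel_measurable borel"
        using h(1) by (auto simp: has_bochner_integral_iff dest: borel_measurable_integrable)
      have hint: "integrable ?G (\<lambda>x. \<theta> * h \<theta> x)"
        using h(1) by (auto simp: has_bochner_integral_iff)
      have b: "?b > 0"
        using assms(7)[OF \<theta>(1)] unfolding P assms(6) by (intro wieand_b_pos[of \<alpha> h \<theta>] assms(3) h(1) nonneg)
      \<comment> \<open>the statistic is divided by \<open>sqrt n\<close>, and \<open>n > C / b\<^sup>2\<close> rules out \<open>n = 0\<close>\<close>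
      have n0: "n > 0"
      proof -
        have "0 < K / (\<epsilon>\<^sup>2 * \<gamma>) / ?b\<^sup>2" using K \<epsilon> \<gamma> b by simp
        then have "0 < real n" using n by linarith
        then show ?thesis by simp
      qed
      have h0m: "h0 \<in> borel_measurable ?G" and h02: "integrable ?G (\<lambda>x. (h0 x)\<^sup>2)"
        using assms(12,13) unfolding assms(6) by auto
      have h2: "integrable ?G (\<lambda>x. (h \<theta> x)\<^sup>2)" "(\<integral>x. (h \<theta> x)\<^sup>2 \<partial>?G) \<le> 2 * (\<integral>x. (h0 x)\<^sup>2 \<partial>?G) + 2"
        using square_integrable_of_L2_close[OF _ h0m h02, of "h \<theta>"] close[OF \<theta>(2,3)] by auto
      have "(\<integral>x. (\<theta> * h \<theta> x)\<^sup>2 \<partial>?G) = \<theta>\<^sup>2 * (\<integral>x. (h \<theta> x)\<^sup>2 \<partial>?G)"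
        by (simp add: power_mult_distrib)
      also have "\<dots> \<le> (\<integral>x. (h \<theta> x)\<^sup>2 \<partial>?G)"
        using \<theta>(4) by (intro mult_left_le_one_le) (auto simp: abs_square_le_1)
      finally have var: "integrable ?Q (\<lambda>x. (x - \<alpha>)\<^sup>2)" "(\<integral>x. (x - \<alpha>)\<^sup>2 \<partial>?Q) \<le> V"
        using tilted_gamma_variance_le[OF a0 _ _ nonneg] h2 by (auto simp: V_def power_mult_distrib)
      have mean: "has_bochner_integral ?Q (\<lambda>x. x) \<alpha>"
      proof (rule has_bochner_integral_density)
        have "has_bochner_integral ?G (\<lambda>x. x + \<theta> * (x * h \<theta> x)) (\<alpha> + \<theta> * 0)"
          using gamma_distribution_moment[OF a0, of 1]
          by (intro has_bochner_integral_add has_bochner_integral_mult_right h) auto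
        then show "has_bochner_integral ?G (\<lambda>x. (1 + \<theta> * h \<theta> x) *\<^sub>R x) \<alpha>"
          by (simp add: algebra_simps)
      qed (use nonneg in auto)
      have pos: "AE x in ?Q. x \<ge> 0"
        using AE_gamma_distribution_pos[OF a0] by (subst AE_density) (auto elim!: eventually_mono)
      have b_eq: "?b = sqrt (\<integral>t. ((\<integral>x. bessel_kernel \<alpha> (t * x / \<alpha>) \<partial>?Q) - exp (- t / \<alpha>))\<^sup>2 \<partial>?G)"
        unfolding wieand_b_eq[of \<alpha> h \<theta>, OF a0 hm]
      proof (intro arg_cong[where f = sqrt] integral_cong_AE)
        show "AE t in ?G. (\<integral>x. bessel_kernel \<alpha> (t * x / \<alpha>) * (\<theta> * h \<theta> x) \<partial>?G)\<^sup>2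
            = ((\<integral>x. bessel_kernel \<alpha> (t * x / \<alpha>) \<partial>?Q) - exp (- t / \<alpha>))\<^sup>2"
          using AE_gamma_distribution_pos[OF a0]
          by eventually_elim (simp only: kernel_mean_diff_eq[OF assms(3) hint nonneg less_imp_le])
        interpret G: prob_space ?G by (rule prob_space_gamma_distribution[OF a0])
        show "(\<lambda>t. (\<integral>x. bessel_kernel \<alpha> (t * x / \<alpha>) * (\<theta> * h \<theta> x) \<partial>?G)\<^sup>2) \<in> borel_measurable ?G"
          by measurable
        interpret Q: prob_space ?Q
          using assms(5)[of \<theta>] \<theta>(1) P by (simp add: \<Theta>\<^sub>1_def)
        show "(\<lambda>t. ((\<integral>x. bessel_kernel \<alpha> (t * x / \<alpha>) \<partial>?Q) - exp (- t / \<alpha>))\<^sup>2) \<in> borel_measurable ?G"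
          by measurable
      qed
      have "1 - K / (real n * (\<epsilon> * ?b)\<^sup>2) \<le> measure (M \<theta>) {\<omega> \<in> space (M \<theta>).
          \<bar>T_statistic \<alpha> n (\<lambda>j. X j \<omega>) / sqrt (real n) - ?b\<bar> < \<epsilon> * ?b}"
        unfolding K_def
        using T_statistic_concentration[OF assms(3) n0 assms(15,16)[OF \<theta>(1)] _ pos mean var b_eq, of "\<epsilon> * ?b"]
          assms(17)[OF \<theta>(1)] P \<epsilon> b by simp
      moreover have "K / (real n * (\<epsilon> * ?b)\<^sup>2) < \<gamma>"
        using n n0 \<epsilon> \<gamma> b by (simp add: field_simps)
      ultimately show "1 - \<gamma> < measure (M \<theta>) {\<omega> \<in> space (M \<theta>).
          \<bar>T_statistic \<alpha> n (\<lambda>j. X j \<omega>) / sqrt (real n) - ?b\<bar> < \<epsilon> * ?b}"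
        by linarith
    qed
  qed (use \<delta> in auto)
qed

end
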